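(* Let $n$ be a positive integer, let $P(y)$ and $Q(y)$ be Wilson difference polynomials in $y$ with $\deg_f Q\le n$, and let $f\not\equiv0$ be a meromorphic solution on $\mathbb{C}$, of finite order $\sigma$, of the Wilson difference equation $$y^nP(y)=Q(y).$$ Then for every $\varepsilon>0$, $$m(r,P(f))=O(r^{\sigma-\frac12+\varepsilon})+O(\ln r)$$ as $r\to\infty$.
   Context: The Wilson operator $\mathcal{D}_{\mathrm{W}}$: for $x\ne0$ and $z$ with $z^2=x$, $$(\mathcal{D}_{\mathrm{W}}f)(x):=\frac{f((z+\frac i2)^2)-f((z-\frac i2)^2)}{2iz},$$ which does not depend on the choice of $z$; at $x=0$ the value is the limit as $x\to0$, which is $f'(-\frac14)$ if $f$ is differentiable at $-\frac14$. If $f$ is meromorphic on $\mathbb{C}$, so is $\mathcal{D}_{\mathrm{W}}f$. $\mathcal{D}_{\mathrm{W}}^l$ denotes the $l$-fold iterate, with $\mathcal{D}_{\mathrm{W}}^0f=f$. A Wilson difference polynomial in $f$ is a finite sum of finite products of the form $P(f)=\sum_jP_j\prod_l(\mathcal{D}_{\mathrm{W}}^lf)^{d_{l,j}}$, where the $d_{l,j}$ are non-negative integers and the coefficients $P_j$ are polynomials in the one variable $x$. Its degree over $f$ is $\deg_fP:=\max_j\sum_ld_{l,j}$. $m(r,g)=\frac1{2\pi}\int_0^{2\pi}\ln^+|g(re^{i\theta})|\,d\theta$ is the Nevanlinna proximity function. The order of $f$ is $\limsup_{r\to\infty}\frac{\ln^+T(r,f)}{\ln r}$, with $T$ the Nevanlinna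 characteristic. *)

theory Defs
  imports "HOL-Complex_Analysis.Complex_Analysis" "HOL-Library.Landau_Symbols"
begin

text \<open>
  Meromorphic functions are represented, as in the library, by total functions whose values on a
  set without limit points are irrelevant. Identities between meromorphic functions are therefore
  stated with \<open>\<forall>\<^sub>\<approx>x. \<dots>\<close>. All the notions below are insensitive to such exceptional values, up to
  exceptional values of the resulting functions.
\<close>

definition wilson_quotient :: "(complex \<Rightarrow> complex) \<Rightarrow> complex \<Rightarrow> complex" where
  "wilson_quotient f z = (f ((z + \<i> / 2)\<^sup>2) - f ((z - \<i> / 2)\<^sup>2)) / (2 * \<i> * z)"

definition wilson :: "(complex \<Rightarrow> complex) \<Rightarrow> complex \<Rightarrow> complex" where
  "wilson f x =
     (if x = 0 then Lim (at 0) (\<lambda>w. wilson_quotient f (csqrt w))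
      else wilson_quotient f (csqrt x))"

lemma wilson_quotient_minus: "wilson_quotient f (- z) = wilson_quotient f z"
proof -
  have "(- z + \<i> / 2)\<^sup>2 = (z - \<i> / 2)\<^sup>2" "(- z - \<i> / 2)\<^sup>2 = (z + \<i> / 2)\<^sup>2"
    by (simp_all add: power2_eq_square algebra_simps)
  thus ?thesis
    by (simp add: wilson_quotient_def minus_divide_left)
qed

lemma wilson_eq:
  assumes "z\<^sup>2 = x" "x \<noteq> 0"
  shows "wilson f x = (f ((z + \<i> / 2)\<^sup>2) - f ((z - \<i> / 2)\<^sup>2)) / (2 * \<i> * z)"
proof -
  have "csqrt x = z \<or> csqrt x = - z"
    using assms(1) by (metis power2_csqrt power2_eq_iff)
  thus ?thesis
    using assms(2) wilson_quotient_minus[of f z] by (auto simp: wilson_def wilson_quotient_def)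
qed

lemma wilson_0:
  assumes "f field_differentiable (at (- 1 / 4))"
  shows "wilson f 0 = deriv f (- 1 / 4)"
proof -
  have "(f has_field_derivative deriv f (- 1 / 4)) (at (- 1 / 4))"
    using assms by (simp add: DERIV_deriv_iff_field_differentiable)
  then obtain g where g: "\<And>w. f w - f (- 1 / 4) = g w * (w - (- 1 / 4))"
      "isCont g (- 1 / 4)" "g (- 1 / 4) = deriv f (- 1 / 4)"
    unfolding CARAT_DERIV by blast
  have sq: "(csqrt \<longlongrightarrow> 0) (at (0::complex))"
  proof (rule Lim_null_comparison)
    show "\<forall>\<^sub>F w in at (0::complex). norm (csqrt w) \<le> sqrt (norm w)"
      by simp
    show "((\<lambda>w. sqrt (norm w)) \<longlongrightarrow> 0) (at (0::complex))"
      by (auto intro!: tendsto_eq_intros)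
  qed
  have plus: "(z + \<i> / 2)\<^sup>2 = - 1 / 4 + z * (z + \<i>)" and minus: "(z - \<i> / 2)\<^sup>2 = - 1 / 4 + z * (z - \<i>)" for z
    by (simp_all add: power2_eq_square algebra_simps)
  define h where
    "h z = (g (- 1 / 4 + z * (z + \<i>)) * (z + \<i>) - g (- 1 / 4 + z * (z - \<i>)) * (z - \<i>)) / (2 * \<i>)" for z
  have q: "wilson_quotient f z = h z" if "z \<noteq> 0" for z
  proof -
    have "f ((z + \<i> / 2)\<^sup>2) - f ((z - \<i> / 2)\<^sup>2) =
            (f ((z + \<i> / 2)\<^sup>2) - f (- 1 / 4)) - (f ((z - \<i> / 2)\<^sup>2) - f (- 1 / 4))"
      by simp
    also have "\<dots> = z * (g (- 1 / 4 + z * (z + \<i>)) * (z + \<i>) - g (- 1 / 4 + z * (z - \<i>)) * (z - \<i>))"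
      unfolding g(1) plus minus by (simp add: algebra_simps)
    finally show ?thesis
      using that by (simp add: wilson_quotient_def h_def)
  qed
  have gl: "((\<lambda>w. g (u w)) \<longlongrightarrow> deriv f (- 1 / 4)) (at 0)"
    if "(u \<longlongrightarrow> - 1 / 4) (at 0)" for u :: "complex \<Rightarrow> complex"
    using isCont_tendsto_compose[OF g(2) that] g(3) by simp
  have "((\<lambda>w. h (csqrt w)) \<longlongrightarrow>
          (deriv f (- 1 / 4) * (0 + \<i>) - deriv f (- 1 / 4) * (0 - \<i>)) / (2 * \<i>)) (at 0)"
    unfolding h_def by (intro tendsto_intros gl sq) (auto intro!: tendsto_eq_intros sq)
  moreover have "\<forall>\<^sub>F w in at 0. h (csqrt w) = wilson_quotient f (csqrt w)"
    by (auto simp: eventually_at_filter q)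
  ultimately have "((\<lambda>w. wilson_quotient f (csqrt w)) \<longlongrightarrow> deriv f (- 1 / 4)) (at 0)"
    by (simp add: tendsto_cong)
  thus ?thesis
    by (simp add: wilson_def tendsto_Lim)
qed

text \<open>
  A Wilson difference polynomial is a finite list of terms \<open>(P\<^sub>j, [d\<^sub>0\<^sub>j, d\<^sub>1\<^sub>j, \<dots>])\<close>: a coefficient
  in \<open>\<complex>[x]\<close> and the exponents of \<open>f\<close>, of its first Wilson difference, and so on; exponents
  beyond the end of the list are zero.
\<close>

type_synonym wilson_poly = "(complex poly \<times> nat list) list"

definition wilson_poly_eval :: "wilson_poly \<Rightarrow> (complex \<Rightarrow> complex) \<Rightarrow> complex \<Rightarrow> complex" where
  "wilson_poly_eval P f x =
     (\<Sum>(c, d) \<leftarrow> P. poly c x * (\<Prod>l<length d. ((wilson ^^ l) f x) ^ (d ! l)))"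

text \<open>The inserted \<open>0\<close> only matters for the empty sum, which gets degree \<open>0\<close>.\<close>

definition wilson_poly_degree :: "wilson_poly \<Rightarrow> nat" where
  "wilson_poly_degree P = Max (insert 0 ((\<lambda>(c, d). sum_list d) ` set P))"

definition ln_plus :: "real \<Rightarrow> real" where
  "ln_plus x = ln (max 1 x)"

definition proximity :: "real \<Rightarrow> (complex \<Rightarrow> complex) \<Rightarrow> real" where
  "proximity r g =
     1 / (2 * pi) * integral {0..2 * pi} (\<lambda>\<theta>. ln_plus (cmod (g (of_real r * exp (\<i> * of_real \<theta>)))))"

definition pole_mult :: "(complex \<Rightarrow> complex) \<Rightarrow> complex \<Rightarrow> nat" where
  "pole_mult f z = (if is_pole f z then nat (- zorder f z) else 0)"

definition pole_count :: "real \<Rightarrow> (complex \<Rightarrow> complex) \<Rightarrow> nat" where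
  "pole_count t f = (\<Sum>z | cmod z \<le> t \<and> is_pole f z. pole_mult f z)"

definition counting :: "real \<Rightarrow> (complex \<Rightarrow> complex) \<Rightarrow> real" where
  "counting r f =
     integral {0..r} (\<lambda>t. (real (pole_count t f) - real (pole_count 0 f)) / t)
       + real (pole_count 0 f) * ln r"

definition characteristic :: "real \<Rightarrow> (complex \<Rightarrow> complex) \<Rightarrow> real" where
  "characteristic r f = proximity r f + counting r f"

definition nevanlinna_order :: "(complex \<Rightarrow> complex) \<Rightarrow> ereal" where
  "nevanlinna_order f = Limsup at_top (\<lambda>r. ereal (ln_plus (characteristic r f) / ln r))"

end

theory Submission
  imports Defs
begin

text \<open>
  For \<open>\<bar>z\<bar> > l\<close> the iterate \<open>D\<^sub>W\<^sup>l f\<close> at \<open>z\<^sup>2\<close> is a linear combination, with bounded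
  coefficients, of values of \<open>f\<close> at the points \<open>(z + \<i> k / 2)\<^sup>2\<close>, \<open>\<bar>k\<bar> \<le> l\<close>. So Clunie's argument only needs the proximity
  functions of the quotients \<open>f ((z + \<i> k / 2)\<^sup>2) / f (z\<^sup>2)\<close>, and no control of the order of \<open>D\<^sub>W f\<close>.

  To bound these, take out the zeros and poles in a disc of radius \<open>R\<close> comparable to \<open>r = \<bar>z\<bar>\<^sup>2\<close> by Blaschke
  factors: \<open>f = exp G \<cdot> \<Prod>\<^sub>a b\<^sub>a\<^bsup>m(a)\<^esup>\<close>. Cauchy's formula bounds \<open>G'\<close> by the mean of \<open>\<bar>ln \<bar>f\<bar>\<bar>\<close> over the
  circle of radius \<open>R\<close>, which by Jensen's formula is at most \<open>2 T(R, f) + O(1)\<close>, and Jensen's formula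
  also bounds the number of zeros and poles. The two points are only \<open>O(\<surd>r)\<close> apart, which yields the
  factor \<open>r\<^bsup>-1/2\<^esup>\<close>.
\<close>

section \<open>Bounds for Wilson difference polynomials\<close>

text \<open>The bound is claimed for all large r, so zeros and poles of f may lie on or arbitrarily
  near the circle of radius r, where logarithmic quotients have no useful pointwise bound. Each zero
  or pole a is therefore given an integrable majorant in \<theta> whose integral is bounded
  independently of the position of a. The auxiliary radius R, in contrast, is free in an interval
  and is chosen so that its circle carries no exceptional point at all.

  The circle of radius r is parametrised as z^2 with z = sqrt r * cis (\<theta> / 2): the square
  root is then continuous in \<theta>, and the shifts in the Wilson operator become translations of
  z.

  The exponent arises as follows. There are O(r^(\<sigma>+\<epsilon>/2)) zeros and poles of modulus
  below R. For a displacement d of order sqrt r, each contributes on average d^\<alpha> *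
  r^(-\<alpha>), which is of order r^(-\<alpha>/2), and \<alpha> is taken close to 1.\<close>

lemma norm_funpow_wilson_le:
  assumes "real l + 1 \<le> norm z" and "\<And>k::int. \<bar>k\<bar> \<le> int l \<Longrightarrow> norm (f ((z + \<i> * of_int k / 2)\<^sup>2)) \<le> B"
  shows "norm ((wilson ^^ l) f (z\<^sup>2)) \<le> B"
  using assms
proof (induction l arbitrary: z)
  case 0
  from 0(2)[of 0] show ?case by simp
next
  case (Suc l)
  have z0: "z \<noteq> 0" "1 \<le> norm z" using Suc.prems(1) by auto
  have IH: "norm ((wilson ^^ l) f ((z + \<i> * of_int e / 2)\<^sup>2)) \<le> B" if e: "\<bar>e\<bar> = 1" for e :: int
  proof (rule Suc.IH)
    have "norm (\<i> * of_int e / 2 :: complex) = 1 / 2"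
      using e by (simp add: norm_mult norm_divide flip: of_int_abs)
    thus "real l + 1 \<le> norm (z + \<i> * of_int e / 2)"
      using norm_diff_ineq[of z "\<i> * of_int e / 2"] Suc.prems(1) by simp
    fix k :: int assume "\<bar>k\<bar> \<le> int l"
    hence "\<bar>e + k\<bar> \<le> int (Suc l)" using e by linarith
    from Suc.prems(2)[OF this]
    show "norm (f ((z + \<i> * of_int e / 2 + \<i> * of_int k / 2)\<^sup>2)) \<le> B"
      by (simp add: field_simps)
  qed
  have "norm ((wilson ^^ l) f ((z + \<i> / 2)\<^sup>2)) \<le> B" "norm ((wilson ^^ l) f ((z - \<i> / 2)\<^sup>2)) \<le> B"
    using IH[of 1] IH[of "-1"] by auto
  hence "norm ((wilson ^^ l) f ((z + \<i> / 2)\<^sup>2) - (wilson ^^ l) f ((z - \<i> / 2)\<^sup>2)) \<le> 2 * B"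
    by (intro order.trans[OF norm_triangle_ineq4]) simp
  \<comment> \<open>The divisor \<open>2 * \<i> * z\<close> has modulus at least 2, so the factor 2
    from the difference is cancelled and \<open>B\<close> does not grow with
    \<open>l\<close>.\<close>
  also have "\<dots> \<le> 2 * norm z * B"
    using z0 order.trans[OF norm_ge_zero \<open>norm ((wilson ^^ l) f ((z + \<i> / 2)\<^sup>2)) \<le> B\<close>]
    by (simp add: mult_le_cancel_right1)
  finally show ?case
    using z0 by (simp add: wilson_eq[OF refl] norm_divide norm_mult field_simps)
qed

lemma norm_poly_le:
  fixes c :: "complex poly"
  obtains K where "K \<ge> 0" "\<And>x. norm x \<ge> 1 \<Longrightarrow> norm (poly c x) \<le> K * norm x ^ degree c"
proof
  show "(\<Sum>i\<le>degree c. norm (coeff c i)) \<ge> 0" by (intro sum_nonneg) auto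
  fix x :: complex assume x: "norm x \<ge> 1"
  show "norm (poly c x) \<le> (\<Sum>i\<le>degree c. norm (coeff c i)) * norm x ^ degree c"
    unfolding poly_altdef sum_distrib_right
    by (rule sum_norm_le) (auto simp: norm_mult norm_power intro!: mult_left_mono power_increasing x)
qed

text \<open>In the application \<open>y\<close> is the modulus of f at x and \<open>U\<close> bounds
  the quotients of shifted values of f by f x. Replacing \<open>y\<close> by \<open>max 1 y\<close>
  makes the base at least 1, so that every term of degree at most \<open>D\<close> obeys the same
  bound.\<close>

lemma wilson_term_bound:
  assumes "\<And>l. l < length d \<Longrightarrow> norm ((wilson ^^ l) f x) \<le> U * y"
    and "1 \<le> U" "0 < y" and "sum_list d \<le> D"
  shows "norm (\<Prod>l<length d. ((wilson ^^ l) f x) ^ (d ! l)) \<le> U ^ D * max 1 y ^ D"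
proof -
  have "norm (\<Prod>l<length d. ((wilson ^^ l) f x) ^ (d ! l)) = (\<Prod>l<length d. norm ((wilson ^^ l) f x) ^ (d ! l))"
    by (simp add: norm_power flip: prod_norm)
  also have "\<dots> \<le> (\<Prod>l<length d. (U * max 1 y) ^ (d ! l))"
  proof (intro prod_mono conjI power_mono)
    fix l assume "l \<in> {..<length d}"
    hence "norm ((wilson ^^ l) f x) \<le> U * y" using assms(1) by simp
    also have "\<dots> \<le> U * max 1 y" using assms(2) by (intro mult_left_mono) auto
    finally show "norm ((wilson ^^ l) f x) \<le> U * max 1 y" .
  qed auto
  also have "\<dots> = (U * max 1 y) ^ sum_list d"
    by (simp add: sum_list_sum_nth power_sum lessThan_atLeast0)
  also have "\<dots> \<le> (U * max 1 y) ^ D"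
  proof (rule power_increasing)
    have "1 * 1 \<le> U * max 1 y" using assms(2) by (intro mult_mono) auto
    thus "1 \<le> U * max 1 y" by simp
  qed fact
  finally show ?thesis by (simp add: power_mult_distrib)
qed

text \<open>The point is uniformity: \<open>K\<close> and \<open>\<kappa>\<close> depend on
  \<open>P\<close>, \<open>D\<close> and \<open>L\<close> only, whereas \<open>U\<close> and
  \<open>y\<close> will vary from point to point on the circle. Since the modulus of x is at least
  1, the degrees of the coefficients can be merged into one exponent.\<close>

lemma wilson_poly_eval_bound:
  assumes "\<And>c d. (c, d) \<in> set P \<Longrightarrow> sum_list d \<le> D \<and> length d \<le> L"
  obtains K \<kappa> where "K \<ge> 0"
    "\<And>f x y U. \<lbrakk>1 \<le> norm x; 1 \<le> U; 0 < y; \<And>l. l < L \<Longrightarrow> norm ((wilson ^^ l) f x) \<le> U * y\<rbrakk> \<Longrightarrow>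
       norm (wilson_poly_eval P f x) \<le> K * norm x ^ \<kappa> * (U ^ D * max 1 y ^ D)"
proof -
  have "\<exists>K \<kappa>. K \<ge> 0 \<and> (\<forall>f x y U. 1 \<le> norm x \<longrightarrow> 1 \<le> U \<longrightarrow> 0 < y \<longrightarrow> (\<forall>l<L. norm ((wilson ^^ l) f x) \<le> U * y) \<longrightarrow>
       norm (wilson_poly_eval P f x) \<le> K * norm x ^ \<kappa> * (U ^ D * max 1 y ^ D))"
    using assms
  proof (induction P)
    case Nil
    show ?case by (intro exI[of _ 0]) (auto simp: wilson_poly_eval_def)
  next
    case (Cons cd P)
    obtain c d where cd: "cd = (c, d)" by force
    from Cons obtain K \<kappa> where K: "K \<ge> 0" "\<And>f x y U. \<lbrakk>1 \<le> norm x; 1 \<le> U; 0 < y; \<forall>l<L. norm ((wilson ^^ l) f x) \<le> U * y\<rbrakk> \<Longrightarrow>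
       norm (wilson_poly_eval P f x) \<le> K * norm x ^ \<kappa> * (U ^ D * max 1 y ^ D)"
      by (metis list.set_intros(2))
    obtain K' where K': "K' \<ge> 0" "\<And>x. norm x \<ge> 1 \<Longrightarrow> norm (poly c x) \<le> K' * norm x ^ degree c"
      using norm_poly_le by blast
    have d: "sum_list d \<le> D" "length d \<le> L" using Cons.prems[of c d] by (auto simp: cd)
    define \<kappa>' where "\<kappa>' = max \<kappa> (degree c)"
    show ?case
    proof (intro exI[of _ "K + K'"] exI[of _ \<kappa>'] conjI allI impI)
      show "K + K' \<ge> 0" using K K' by simp
      fix f x y U
      assume *: "1 \<le> norm x" "1 \<le> U" "0 < (y::real)" "\<forall>l<L. norm ((wilson ^^ l) f x) \<le> U * y"
      define X where "X = U ^ D * max 1 y ^ D"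
      have X: "X \<ge> 0" using * by (simp add: X_def)
      have "norm (wilson_poly_eval (cd # P) f x) \<le>
          norm (poly c x) * norm (\<Prod>l<length d. ((wilson ^^ l) f x) ^ (d ! l)) + norm (wilson_poly_eval P f x)"
        unfolding wilson_poly_eval_def cd by (simp add: norm_triangle_le norm_mult)
      also have "\<dots> \<le> (K' * norm x ^ degree c) * X + K * norm x ^ \<kappa> * X"
        unfolding X_def
        by (intro add_mono mult_mono K' K wilson_term_bound *) (use * d K' in auto)
      also have "\<dots> \<le> K' * norm x ^ \<kappa>' * X + K * norm x ^ \<kappa>' * X"
        using * K(1) K'(1) X by (intro add_mono mult_right_mono mult_left_mono power_increasing) (auto simp: \<kappa>'_def)
      finally show "norm (wilson_poly_eval (cd # P) f x) \<le> (K + K') * norm x ^ \<kappa>' * (U ^ D * max 1 y ^ D)"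
        by (simp add: X_def algebra_simps)
    qed
  qed
  thus ?thesis using that by blast
qed

section \<open>Integrable majorants of negative powers of distances\<close>

lemma abs_powr_integral:
  fixes c K \<alpha> :: real
  assumes "\<alpha> < 1" "0 \<le> K"
  shows "((\<lambda>t. \<bar>t - c\<bar> powr - \<alpha>) has_integral 2 * (K powr (1 - \<alpha>) / (1 - \<alpha>))) {c - K..c + K}"
proof -
  define I where "I = K powr (1 - \<alpha>) / (1 - \<alpha>)"
  have "((\<lambda>x. x powr - \<alpha>) has_integral I) {0..K}"
    using has_integral_powr_from_0[of "- \<alpha>" K] assms by (simp add: I_def)
  hence 1: "((\<lambda>x. \<bar>x\<bar> powr - \<alpha>) has_integral I) {0..K}"
    by (rule has_integral_eq[rotated]) auto
  have 2: "((\<lambda>x. \<bar>x\<bar> powr - \<alpha>) has_integral I) {-K..0}"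
    using has_integral_reflect_real[of "\<lambda>x. \<bar>x\<bar> powr - \<alpha>" I K 0] 1 by simp
  have "((\<lambda>x. \<bar>x\<bar> powr - \<alpha>) has_integral (I + I)) {-K..K}"
    by (rule has_integral_combine[OF _ _ 2 1]) (use assms in auto)
  from has_integral_shift_real_ivl[OF this, of "- c"] show ?thesis
    by (simp add: I_def algebra_simps)
qed

lemma abs_sin_ge:
  fixes v :: real
  assumes "\<bar>v\<bar> \<le> pi / 2"
  shows "\<bar>v\<bar> / 3 \<le> \<bar>sin v\<bar>"
proof -
  have "\<bar>sin v - (\<Sum>m<3. sin_coeff m * v ^ m)\<bar> \<le> inverse (fact 3) * \<bar>v\<bar> ^ 3"
    by (rule Maclaurin_sin_bound)
  also have "(\<Sum>m<3. sin_coeff m * v ^ m) = v"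
    by (simp add: numeral_3_eq_3 sin_coeff_def)
  finally have 1: "\<bar>sin v - v\<bar> \<le> \<bar>v\<bar> * v\<^sup>2 / 6"
    by (simp add: fact_numeral power3_eq_cube power2_eq_square)
  have "v\<^sup>2 \<le> 2\<^sup>2"
    using assms pi_less_4 by (intro abs_le_square_iff[THEN iffD1]) simp
  hence "\<bar>v\<bar> * v\<^sup>2 \<le> \<bar>v\<bar> * 4" by (intro mult_left_mono) auto
  \<comment> \<open>Since \<bar>v\<bar> is at most 2, the cubic remainder is at most 2/3 of
    \<bar>v\<bar>, which leaves 1/3.\<close>
  thus ?thesis using 1 by linarith
qed

text \<open>The range is that of \<theta>/2 - Arg b for \<theta> in [0, 2 pi]; the four values of
  \<open>j\<close> enumerate the zeros of the sine in it.\<close>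

lemma abs_sin_ge_dist:
  assumes "- pi \<le> u" "u \<le> 2 * pi"
  obtains j :: int where "j \<in> {-1, 0, 1, 2}" "\<bar>u - of_int j * pi\<bar> / 3 \<le> \<bar>sin u\<bar>"
proof -
  consider "u \<le> - pi / 2" | "- pi / 2 \<le> u" "u \<le> pi / 2" | "pi / 2 \<le> u" "u \<le> 3 * pi / 2" | "3 * pi / 2 \<le> u"
    by linarith
  thus ?thesis
  proof cases
    case 1
    have "\<bar>u + pi\<bar> / 3 \<le> \<bar>sin (u + pi)\<bar>" by (rule abs_sin_ge) (use 1 assms in auto)
    thus ?thesis by (intro that[of "-1"]) auto
  next
    case 2
    have "\<bar>u\<bar> / 3 \<le> \<bar>sin u\<bar>" by (rule abs_sin_ge) (use 2 assms in auto)
    thus ?thesis by (intro that[of 0]) auto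
  next
    case 3
    have "\<bar>u - pi\<bar> / 3 \<le> \<bar>sin (u - pi)\<bar>" by (rule abs_sin_ge) (use 3 assms in \<open>auto simp: abs_if\<close>)
    thus ?thesis by (intro that[of 1]) (auto simp: sin_diff)
  next
    case 4
    have "\<bar>u - 2 * pi\<bar> / 3 \<le> \<bar>sin (u - 2 * pi)\<bar>" by (rule abs_sin_ge) (use 4 assms in \<open>auto simp: abs_if\<close>)
    thus ?thesis by (intro that[of 2]) (auto simp: sin_diff)
  qed
qed

text \<open>After rotating b to the positive real axis, the distance is at least the modulus of the
  imaginary part, \<rho> * \<bar>sin u\<bar>, which does not involve the modulus of b. This is why
  \<open>C\<close> can be independent of b. The zeros of the sine leave singularities of order
  \<alpha> < 1 in \<theta>, which are integrable.\<close>

lemma circle_dist_powr_majorant: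
  fixes \<alpha> :: real
  assumes \<alpha>: "0 < \<alpha>" "\<alpha> < 1"
  obtains C where "C > 0"
    "\<And>\<rho> b. \<rho> > 0 \<Longrightarrow> \<exists>h. h integrable_on {0..2*pi} \<and> (\<forall>\<theta>. 0 \<le> h \<theta>) \<and> integral {0..2*pi} h \<le> C * \<rho> powr - \<alpha> \<and>
       (\<forall>\<theta>\<in>{0..2*pi}. norm (of_real \<rho> * cis (\<theta> / 2) - b) powr - \<alpha> \<le> h \<theta>)"
proof -
  \<comment> \<open>The centres \<open>c j\<close> below lie between -4 pi and 6 pi, so the interval
    of half-length \<open>K\<close> around each of them contains [0, 2 pi].\<close>
  define K where "K = 10 * pi"
  define I where "I = 2 * (K powr (1 - \<alpha>) / (1 - \<alpha>))"
  have I: "I > 0" using \<alpha> by (simp add: I_def K_def)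
  define J where "J = {-1, 0, 1, 2 :: int}"
  have "\<exists>h. h integrable_on {0..2*pi} \<and> (\<forall>\<theta>. 0 \<le> h \<theta>) \<and> integral {0..2*pi} h \<le> 4 * (6 powr \<alpha>) * I * \<rho> powr - \<alpha> \<and>
       (\<forall>\<theta>\<in>{0..2*pi}. norm (of_real \<rho> * cis (\<theta> / 2) - b) powr - \<alpha> \<le> h \<theta>)" if \<rho>: "\<rho> > 0" for \<rho> b
  proof -
    define \<beta> where "\<beta> = Arg b"
    have \<beta>: "- pi < \<beta>" "\<beta> \<le> pi" using Arg_bounded[of b] by (auto simp: \<beta>_def)
    have b: "b = of_real (norm b) * cis \<beta>"
      by (metis \<beta>_def rcis_cmod_Arg rcis_def)
    define c where "c j = 2 * \<beta> + 2 * of_int j * pi" for j :: int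
    define h0 where "h0 \<theta> = (\<Sum>j\<in>J. (\<rho> / 6) powr - \<alpha> * \<bar>\<theta> - c j\<bar> powr - \<alpha>)" for \<theta>
    \<comment> \<open>At a centre the singular term of \<open>h0\<close> is 0 by the convention
      \<open>0 powr x = 0\<close> and need not dominate anything. Changing these finitely many
      values makes the bound hold at every angle and leaves the integral alone.\<close>
    define h where "h \<theta> = (if \<theta> \<in> c ` J then norm (of_real \<rho> * cis (\<theta> / 2) - b) powr - \<alpha> else h0 \<theta>)" for \<theta>
    have cJ: "{0..2*pi} \<subseteq> {c j - K..c j + K}" if "j \<in> J" for j
      using that \<beta> by (auto simp: J_def c_def K_def)
    have int: "(\<lambda>\<theta>. \<bar>\<theta> - c j\<bar> powr - \<alpha>) integrable_on {0..2*pi}"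
        "integral {0..2*pi} (\<lambda>\<theta>. \<bar>\<theta> - c j\<bar> powr - \<alpha>) \<le> I" if "j \<in> J" for j
    proof -
      have *: "((\<lambda>t. \<bar>t - c j\<bar> powr - \<alpha>) has_integral I) {c j - K..c j + K}"
        unfolding I_def using abs_powr_integral[of \<alpha> K "c j"] \<alpha> by (simp add: K_def)
      show 1: "(\<lambda>\<theta>. \<bar>\<theta> - c j\<bar> powr - \<alpha>) integrable_on {0..2*pi}"
        by (rule integrable_on_subinterval[OF has_integral_integrable[OF *] cJ[OF that]])
      show "integral {0..2*pi} (\<lambda>\<theta>. \<bar>\<theta> - c j\<bar> powr - \<alpha>) \<le> I"
        by (rule has_integral_subset_le[OF cJ[OF that] integrable_integral[OF 1] *]) auto
    qed
    have h0: "h0 integrable_on {0..2*pi}"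
      unfolding h0_def by (intro integrable_sum integrable_on_mult_right int) (auto simp: J_def)
    have fin: "finite (c ` J)" by (simp add: J_def)
    have hh0: "h integrable_on {0..2*pi}"
      by (rule integrable_spike_finite[OF fin _ h0]) (auto simp: h_def)
    have "integral {0..2*pi} h = integral {0..2*pi} h0"
      by (rule integral_spike[OF negligible_finite[OF fin]]) (auto simp: h_def)
    also have "\<dots> = (\<Sum>j\<in>J. (\<rho> / 6) powr - \<alpha> * integral {0..2*pi} (\<lambda>\<theta>. \<bar>\<theta> - c j\<bar> powr - \<alpha>))"
      unfolding h0_def by (subst integral_sum) (auto simp: J_def intro!: integrable_on_mult_right int)
    also have "\<dots> \<le> (\<Sum>j\<in>J. (\<rho> / 6) powr - \<alpha> * I)"
      by (intro sum_mono mult_left_mono int) auto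
    also have "\<dots> = 4 * ((\<rho> / 6) powr - \<alpha> * I)" by (simp add: J_def)
    also have "(\<rho> / 6) powr - \<alpha> = 6 powr \<alpha> * \<rho> powr - \<alpha>"
      using \<rho> by (simp add: powr_divide powr_minus field_simps)
    finally have ih: "integral {0..2*pi} h \<le> 4 * (6 powr \<alpha>) * I * \<rho> powr - \<alpha>" by (simp add: mult_ac)
    have "norm (of_real \<rho> * cis (\<theta> / 2) - b) powr - \<alpha> \<le> h \<theta>" if \<theta>: "\<theta> \<in> {0..2*pi}" for \<theta>
    proof (cases "\<theta> \<in> c ` J")
      case False
      define u where "u = \<theta> / 2 - \<beta>"
      have "- pi \<le> u" "u \<le> 2 * pi" using \<theta> \<beta> by (auto simp: u_def)
      then obtain j where j: "j \<in> J" "\<bar>u - of_int j * pi\<bar> / 3 \<le> \<bar>sin u\<bar>"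
        using abs_sin_ge_dist unfolding J_def by metis
      have ne: "\<theta> \<noteq> c j" using False j by auto
      \<comment> \<open>The 6 is the 3 of the sine bound times the 2 of the half angle.\<close>
      have e: "\<rho> * (\<bar>u - of_int j * pi\<bar> / 3) = \<rho> / 6 * \<bar>\<theta> - c j\<bar>"
        by (simp add: u_def c_def abs_if field_simps)
      have "cis (\<theta> / 2) = cis \<beta> * cis u"
        by (simp add: cis_mult u_def)
      hence "of_real \<rho> * cis (\<theta> / 2) - b = cis \<beta> * (of_real \<rho> * cis u - of_real (norm b))"
        by (subst b) (simp add: algebra_simps)
      hence "norm (of_real \<rho> * cis (\<theta> / 2) - b) = norm (of_real \<rho> * cis u - of_real (norm b))"
        by (simp add: norm_mult)
      also have "\<dots> \<ge> \<bar>Im (of_real \<rho> * cis u - of_real (norm b))\<bar>" by (rule abs_Im_le_cmod)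
      also have "\<bar>Im (of_real \<rho> * cis u - of_real (norm b))\<bar> = \<rho> * \<bar>sin u\<bar>"
        using \<rho> by (simp add: abs_mult)
      finally have "norm (of_real \<rho> * cis (\<theta> / 2) - b) \<ge> \<rho> * \<bar>sin u\<bar>" .
      moreover have "\<rho> * (\<bar>u - of_int j * pi\<bar> / 3) \<le> \<rho> * \<bar>sin u\<bar>"
        using j \<rho> by (intro mult_left_mono) auto
      ultimately have ge: "\<rho> / 6 * \<bar>\<theta> - c j\<bar> \<le> norm (of_real \<rho> * cis (\<theta> / 2) - b)"
        unfolding e by linarith
      have "norm (of_real \<rho> * cis (\<theta> / 2) - b) powr - \<alpha> \<le> (\<rho> / 6 * \<bar>\<theta> - c j\<bar>) powr - \<alpha>"
        using \<alpha> ne \<rho> by (intro powr_mono2' ge) auto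
      also have "\<dots> = (\<rho> / 6) powr - \<alpha> * \<bar>\<theta> - c j\<bar> powr - \<alpha>"
        by (rule powr_mult)
      also have "\<dots> \<le> h0 \<theta>"
        unfolding h0_def using j by (intro member_le_sum) (auto simp: J_def)
      finally show ?thesis using False by (simp add: h_def)
    qed (simp add: h_def)
    moreover have "\<forall>\<theta>. 0 \<le> h \<theta>" by (auto simp: h_def h0_def intro!: sum_nonneg)
    ultimately show ?thesis using hh0 ih by blast
  qed
  moreover have "4 * (6 powr \<alpha>) * I > 0" using I by simp
  ultimately show ?thesis using that by blast
qed

text \<open>The factors of \<open>(z + \<i> s / 2)\<^sup>2 - a\<close> cannot both be small, since their sum is \<open>2 z + \<i> s\<close>.\<close>

lemma shifted_square_dist_powr_majorant:
  fixes \<alpha> :: real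
  assumes \<alpha>: "0 < \<alpha>" "\<alpha> < 1"
  obtains C where "C > 0"
    "\<And>\<rho> s a. \<lbrakk>\<rho> > 0; \<bar>s\<bar> \<le> \<rho>\<rbrakk> \<Longrightarrow> \<exists>h. h integrable_on {0..2*pi} \<and> (\<forall>\<theta>. 0 \<le> h \<theta>) \<and>
       integral {0..2*pi} h \<le> C * (\<rho>\<^sup>2) powr - \<alpha> \<and>
       (\<forall>\<theta>\<in>{0..2*pi}. norm ((of_real \<rho> * cis (\<theta> / 2) + \<i> * of_real s / 2)\<^sup>2 - a) powr - \<alpha> \<le> h \<theta>)"
proof -
  obtain C where C: "C > 0"
    "\<And>\<rho> b. \<rho> > 0 \<Longrightarrow> \<exists>h. h integrable_on {0..2*pi} \<and> (\<forall>\<theta>. 0 \<le> h \<theta>) \<and> integral {0..2*pi} h \<le> C * \<rho> powr - \<alpha> \<and>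
       (\<forall>\<theta>\<in>{0..2*pi}. norm (of_real \<rho> * cis (\<theta> / 2) - b) powr - \<alpha> \<le> h \<theta>)"
    using circle_dist_powr_majorant[OF \<alpha>] by metis
  have "\<exists>h. h integrable_on {0..2*pi} \<and> (\<forall>\<theta>. 0 \<le> h \<theta>) \<and>
       integral {0..2*pi} h \<le> (2 * 2 powr \<alpha> * C) * (\<rho>\<^sup>2) powr - \<alpha> \<and>
       (\<forall>\<theta>\<in>{0..2*pi}. norm ((of_real \<rho> * cis (\<theta> / 2) + \<i> * of_real s / 2)\<^sup>2 - a) powr - \<alpha> \<le> h \<theta>)"
    if \<rho>: "\<rho> > 0" and s: "\<bar>s\<bar> \<le> \<rho>" for \<rho> s a
  proof -
    \<comment> \<open>These are the two roots in z of (z + \<i> s / 2)^2 = a.\<close>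
    define b1 b2 where "b1 = csqrt a - \<i> * of_real s / 2" and "b2 = - csqrt a - \<i> * of_real s / 2"
    obtain h1 where h1: "h1 integrable_on {0..2*pi}" "\<forall>\<theta>. 0 \<le> h1 \<theta>" "integral {0..2*pi} h1 \<le> C * \<rho> powr - \<alpha>"
       "\<forall>\<theta>\<in>{0..2*pi}. norm (of_real \<rho> * cis (\<theta> / 2) - b1) powr - \<alpha> \<le> h1 \<theta>"
      using C(2)[OF \<rho>] by metis
    obtain h2 where h2: "h2 integrable_on {0..2*pi}" "\<forall>\<theta>. 0 \<le> h2 \<theta>" "integral {0..2*pi} h2 \<le> C * \<rho> powr - \<alpha>"
       "\<forall>\<theta>\<in>{0..2*pi}. norm (of_real \<rho> * cis (\<theta> / 2) - b2) powr - \<alpha> \<le> h2 \<theta>"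
      using C(2)[OF \<rho>] by metis
    \<comment> \<open>The larger factor gives a power \<rho>^(-\<alpha>) pointwise and the other one
      gives the same power after integration; together they form the power of \<rho>^2, the modulus
      of z^2.\<close>
    define h where "h \<theta> = (\<rho> / 2) powr - \<alpha> * (h1 \<theta> + h2 \<theta>)" for \<theta>
    have "h integrable_on {0..2*pi}" unfolding h_def
      by (intro integrable_on_mult_right integrable_add h1 h2)
    moreover have "\<forall>\<theta>. 0 \<le> h \<theta>" using h1 h2 by (simp add: h_def)
    moreover have "integral {0..2*pi} h \<le> (2 * 2 powr \<alpha> * C) * (\<rho>\<^sup>2) powr - \<alpha>"
    proof -
      have "integral {0..2*pi} h = (\<rho> / 2) powr - \<alpha> * (integral {0..2*pi} h1 + integral {0..2*pi} h2)"
        unfolding h_def using h1 h2 by (simp add: integral_add)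
      also have "\<dots> \<le> (\<rho> / 2) powr - \<alpha> * (C * \<rho> powr - \<alpha> + C * \<rho> powr - \<alpha>)"
        by (intro mult_left_mono add_mono h1 h2) auto
      also have "(\<rho> / 2) powr - \<alpha> = 2 powr \<alpha> * \<rho> powr - \<alpha>"
        using \<rho> by (simp add: powr_divide powr_minus field_simps)
      also have "(2 powr \<alpha> * \<rho> powr - \<alpha>) * (C * \<rho> powr - \<alpha> + C * \<rho> powr - \<alpha>) = (2 * 2 powr \<alpha> * C) * (\<rho>\<^sup>2) powr - \<alpha>"
        by (simp add: power2_eq_square powr_mult)
      finally show ?thesis .
    qed
    moreover have "norm ((of_real \<rho> * cis (\<theta> / 2) + \<i> * of_real s / 2)\<^sup>2 - a) powr - \<alpha> \<le> h \<theta>"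
      if \<theta>: "\<theta> \<in> {0..2*pi}" for \<theta>
    proof -
      define z where "z = of_real \<rho> * cis (\<theta> / 2)"
      have nz: "norm z = \<rho>" using \<rho> by (simp add: z_def norm_mult)
      have aa: "a = csqrt a ^ 2" by simp
      have "(z + \<i> * of_real s / 2)\<^sup>2 - a = (z - b1) * (z - b2)"
        by (subst aa) (simp add: b1_def b2_def power2_eq_square field_simps)
      hence p: "norm ((z + \<i> * of_real s / 2)\<^sup>2 - a) = norm (z - b1) * norm (z - b2)"
        by (simp add: norm_mult)
      have "2 * \<rho> - \<bar>s\<bar> \<le> norm (2 * z + \<i> * of_real s)"
        using norm_diff_ineq[of "2 * z" "\<i> * of_real s"] by (simp add: norm_mult nz)
      also have "2 * z + \<i> * of_real s = (z - b1) + (z - b2)"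
        by (simp add: b1_def b2_def)
      also have "norm \<dots> \<le> norm (z - b1) + norm (z - b2)" by (rule norm_triangle_ineq)
      finally have dist: "\<rho> / 2 \<le> norm (z - b1) \<or> \<rho> / 2 \<le> norm (z - b2)" using s by linarith
      have *: "(x * y) powr - \<alpha> \<le> (\<rho> / 2) powr - \<alpha> * y powr - \<alpha>" if "\<rho> / 2 \<le> x" "0 \<le> y" for x y :: real
        unfolding powr_mult using that \<rho> \<alpha> by (intro mult_right_mono powr_mono2') auto
      have "(norm (z - b1) * norm (z - b2)) powr - \<alpha> \<le> (\<rho> / 2) powr - \<alpha> * (norm (z - b1) powr - \<alpha> + norm (z - b2) powr - \<alpha>)"
        using dist
      proof
        assume "\<rho> / 2 \<le> norm (z - b1)"
        from *[OF this, of "norm (z - b2)"] show ?thesis by (simp add: distrib_left add_increasing)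
      next
        assume "\<rho> / 2 \<le> norm (z - b2)"
        from *[OF this, of "norm (z - b1)"] show ?thesis by (simp add: distrib_left add_increasing2 mult.commute)
      qed
      also have "\<dots> \<le> h \<theta>"
        unfolding h_def using h1(4) h2(4) \<theta> by (intro mult_left_mono add_mono) (auto simp: z_def)
      finally show ?thesis using p by (simp only: z_def)
    qed
    ultimately show ?thesis by blast
  qed
  moreover have "2 * 2 powr \<alpha> * C > 0" using C by simp
  ultimately show ?thesis using that by blast
qed

section \<open>Boundary estimates for holomorphic functions\<close>

text \<open>This is the differentiated Schwarz formula. Cauchy's formula for the derivative involves
  all of G on the circle; adding the conjugate of an integral that vanishes by Cauchy's theorem,
  with its kernel reflected in the circle, turns G into 2 Re G. The remaining kernel has modulus at
  most R / (R - \<bar>z\<bar>)^2.\<close>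

lemma deriv_bound_Re_boundary:
  fixes G :: "complex \<Rightarrow> complex"
  assumes hol: "G holomorphic_on ball 0 R'" and R: "0 < R" "R < R'" and z: "norm z < R"
  shows "norm (deriv G z) \<le> 2 * R / (R - norm z)\<^sup>2 *
           (1 / (2 * pi) * integral {0..2*pi} (\<lambda>t. \<bar>Re (G (of_real R * exp (\<i> * of_real t)))\<bar>))"
proof -
  define w where "w t = of_real R * cis t" for t
  have nw: "norm (w t) = R" for t
    using R by (simp add: w_def norm_mult)
  have wz: "w t \<noteq> z" for t
    using nw[of t] z by auto
  have w0: "w t \<noteq> 0" for t
    using nw[of t] R by auto
  have wc: "w t * cnj (w t) = of_real R ^ 2" for t
    using complex_norm_square[of "w t"] nw by simp
  have holc: "G holomorphic_on cball 0 R"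
    by (rule holomorphic_on_subset[OF hol]) (use R in auto)
  have 1: "((\<lambda>t. G (w t) / (w t - z)\<^sup>2 * R * \<i> * cis t) has_integral (2 * pi * \<i> * deriv G z)) {0..2*pi}"
  proof -
    have c: "continuous_on (cball 0 R) G" and h: "G holomorphic_on ball 0 R"
      using holc by (auto intro: holomorphic_on_imp_continuous_on holomorphic_on_subset)
    have zb: "z \<in> ball 0 R" using z by simp
    have "deriv G z = 1 / (2 * of_real pi * \<i>) * contour_integral(circlepath 0 R) (\<lambda>u. G u / (u-z)^2)"
      using Cauchy_derivative_integral_circlepath(2)[OF c h zb] by (rule DERIV_imp_deriv)
    hence "contour_integral(circlepath 0 R) (\<lambda>u. G u / (u-z)^2) = 2 * pi * \<i> * deriv G z"
      by simp
    moreover have "((\<lambda>u. G u / (u-z)^2) has_contour_integral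
        contour_integral(circlepath 0 R) (\<lambda>u. G u / (u-z)^2)) (circlepath 0 R)"
      using Cauchy_derivative_integral_circlepath(1)[OF c h zb] by (rule has_contour_integral_integral)
    ultimately show ?thesis
      unfolding circlepath_def w_def by (subst (asm) has_contour_integral_part_circlepath_iff) simp_all
  qed
  have 2: "((\<lambda>t. G (w t) * R\<^sup>2 / (R\<^sup>2 - cnj z * w t)\<^sup>2 * R * \<i> * cis t) has_integral 0) {0..2*pi}"
  proof -
    \<comment> \<open>The reflected kernel has its only pole at the mirror image of z, of modulus
      R^2 / \<bar>z\<bar> > R; for z = 0 there is none, and division by zero would spoil the
      minimum.\<close>
    define R1 where "R1 = (if z = 0 then R' else min R' (R\<^sup>2 / norm z))"
    have R1: "R < R1" "R1 \<le> R'"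
      using R z by (auto simp: R1_def field_simps power2_eq_square)
    have nz: "R\<^sup>2 - cnj z * u \<noteq> 0" if "norm u < R1" for u
    proof
      assume "of_real (R\<^sup>2) - cnj z * u = 0"
      hence "norm (of_real (R\<^sup>2) :: complex) = norm (cnj z * u)" by simp
      hence *: "R\<^sup>2 = norm z * norm u" by (simp add: norm_mult norm_power)
      hence "z \<noteq> 0" using R by auto
      hence "norm u < R\<^sup>2 / norm z" using that by (simp add: R1_def)
      thus False using * \<open>z \<noteq> 0\<close> by (simp add: field_simps)
    qed
    have "((\<lambda>u. G u * R\<^sup>2 / (R\<^sup>2 - cnj z * u)\<^sup>2) has_contour_integral 0) (circlepath 0 R)"
    proof (rule Cauchy_theorem_disc_simple)
      show "(\<lambda>u. G u * R\<^sup>2 / (R\<^sup>2 - cnj z * u)\<^sup>2) holomorphic_on ball 0 R1"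
        using R1 nz by (intro holomorphic_intros holomorphic_on_subset[OF hol]) auto
    qed (use R R1 in auto)
    thus ?thesis
      unfolding circlepath_def w_def by (subst (asm) has_contour_integral_part_circlepath_iff) simp_all
  qed
  have 3: "((\<lambda>t. 2 * of_real (Re (G (w t))) * (w t * \<i> / (w t - z)\<^sup>2)) has_integral (2 * pi * \<i> * deriv G z)) {0..2*pi}"
  proof -
    \<comment> \<open>On the circle R^2 = w * cnj w, so the conjugate of R^2 - cnj z * w is cnj w *
      (w - z). Hence conjugation carries the second kernel to minus the first one.\<close>
    have "((\<lambda>t. G (w t) / (w t - z)\<^sup>2 * R * \<i> * cis t - cnj (G (w t) * R\<^sup>2 / (R\<^sup>2 - cnj z * w t)\<^sup>2 * R * \<i> * cis t))
       has_integral (2 * pi * \<i> * deriv G z - cnj 0)) {0..2*pi}"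
      by (rule has_integral_diff[OF 1 iffD2[OF has_integral_cnj[unfolded comp_def] 2]])
    moreover have "G (w t) / (w t - z)\<^sup>2 * R * \<i> * cis t - cnj (G (w t) * R\<^sup>2 / (R\<^sup>2 - cnj z * w t)\<^sup>2 * R * \<i> * cis t)
        = 2 * of_real (Re (G (w t))) * (w t * \<i> / (w t - z)\<^sup>2)" for t
    proof -
      have e: "cnj (R\<^sup>2 - cnj z * w t) = cnj (w t) * (w t - z)"
        using wc[of t] by (simp add: algebra_simps)
      have "cnj (G (w t) * R\<^sup>2 / (R\<^sup>2 - cnj z * w t)\<^sup>2 * R * \<i> * cis t)
          = cnj (G (w t)) * of_real R ^ 2 / (cnj (R\<^sup>2 - cnj z * w t))\<^sup>2 * (- \<i> * cnj (w t))"
        by (simp add: w_def)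
      also have "\<dots> = - (cnj (G (w t)) * (w t * \<i> / (w t - z)\<^sup>2))"
        unfolding e using wz[of t] w0[of t] wc[of t]
        by (simp add: divide_simps power2_eq_square)
      finally have f: "cnj (G (w t) * R\<^sup>2 / (R\<^sup>2 - cnj z * w t)\<^sup>2 * R * \<i> * cis t) = - (cnj (G (w t)) * (w t * \<i> / (w t - z)\<^sup>2))" .
      have g: "2 * of_real (Re (G (w t))) = G (w t) + cnj (G (w t))"
        by (simp add: complex_add_cnj)
      show ?thesis
        unfolding f g by (simp add: w_def algebra_simps add_divide_distrib)
    qed
    ultimately show ?thesis by simp
  qed
  have conG: "continuous_on {0..2*pi} (\<lambda>t. Re (G (w t)))"
    unfolding w_def by (intro continuous_intros continuous_on_compose2[OF holomorphic_on_imp_continuous_on[OF holc]])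
      (use R in \<open>auto simp: norm_mult\<close>)
  have I: "(\<lambda>t. \<bar>Re (G (w t))\<bar>) integrable_on {0..2*pi}"
    by (intro integrable_continuous_interval continuous_intros conG)
  have "norm (integral {0..2*pi} (\<lambda>t. 2 * of_real (Re (G (w t))) * (w t * \<i> / (w t - z)\<^sup>2)))
     \<le> integral {0..2*pi} (\<lambda>t. 2 * R / (R - norm z)\<^sup>2 * \<bar>Re (G (w t))\<bar>)"
  proof (rule integral_norm_bound_integral)
    show "(\<lambda>t. 2 * R / (R - norm z)\<^sup>2 * \<bar>Re (G (w t))\<bar>) integrable_on {0..2*pi}"
      using I by (rule integrable_on_mult_right)
    fix t
    have "R - norm z \<le> norm (w t - z)"
      using norm_triangle_ineq2[of "w t" z] nw by simp
    hence "(R - norm z)\<^sup>2 \<le> (norm (w t - z))\<^sup>2"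
      using z by (intro power_mono) auto
    hence "R / (norm (w t - z))\<^sup>2 \<le> R / (R - norm z)\<^sup>2"
      using z R by (intro divide_left_mono mult_pos_pos) (use wz in auto)
    hence "2 * \<bar>Re (G (w t))\<bar> * (R / (norm (w t - z))\<^sup>2) \<le> 2 * \<bar>Re (G (w t))\<bar> * (R / (R - norm z)\<^sup>2)"
      by (intro mult_left_mono) auto
    thus "norm (2 * of_real (Re (G (w t))) * (w t * \<i> / (w t - z)\<^sup>2)) \<le> 2 * R / (R - norm z)\<^sup>2 * \<bar>Re (G (w t))\<bar>"
      by (simp add: norm_mult norm_divide norm_power nw mult_ac)
  qed (use 3 in auto)
  also have "integral {0..2*pi} (\<lambda>t. 2 * of_real (Re (G (w t))) * (w t * \<i> / (w t - z)\<^sup>2)) = 2 * pi * \<i> * deriv G z"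
    using 3 by (rule integral_unique)
  finally have "norm (2 * pi * \<i> * deriv G z) / (2 * pi) \<le>
      2 * R / (R - norm z)\<^sup>2 * integral {0..2*pi} (\<lambda>t. \<bar>Re (G (w t))\<bar>) / (2 * pi)"
    by (intro divide_right_mono) auto
  moreover have "norm (2 * pi * \<i> * deriv G z) / (2 * pi) = norm (deriv G z)"
    by (simp add: norm_mult)
  ultimately show ?thesis
    by (simp only: w_def cis_conv_exp) simp
qed

lemma mean_value_Re:
  fixes G :: "complex \<Rightarrow> complex"
  assumes hol: "G holomorphic_on cball 0 R" and R: "0 < R"
  shows "((\<lambda>t. Re (G (of_real R * exp (\<i> * of_real t)))) has_integral (2 * pi * Re (G 0))) {0..2*pi}"
proof -
  have "((\<lambda>u. G u/(u-0)) has_contour_integral (2 * of_real pi * \<i> * G 0)) (circlepath 0 R)"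
    using hol R by (intro Cauchy_integral_circlepath_simple) auto
  hence "((\<lambda>t. G (R * cis t) / (R * cis t) * R * \<i> * cis t) has_integral (2 * pi * \<i> * G 0)) {0..2*pi}"
    unfolding circlepath_def by (subst (asm) has_contour_integral_part_circlepath_iff) simp_all
  moreover have "G (R * cis t) / (R * cis t) * R * \<i> * cis t = \<i> * G (R * cis t)" for t
    using R by (simp add: field_simps)
  ultimately have "((\<lambda>t. \<i> * G (R * cis t)) has_integral (2 * pi * \<i> * G 0)) {0..2*pi}"
    by (simp only:)
  hence "((\<lambda>t. Im (\<i> * G (R * cis t))) has_integral Im (2 * pi * \<i> * G 0)) {0..2*pi}"
    by (rule has_integral_Im)
  thus ?thesis by (simp add: cis_conv_exp)
qed

section \<open>Factorization by Blaschke factors\<close>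

definition blaschke :: "real \<Rightarrow> complex \<Rightarrow> complex \<Rightarrow> complex" where
  "blaschke R a z = of_real R * (z - a) / (of_real (R\<^sup>2) - cnj a * z)"

lemma blaschke_denom_ge:
  assumes "norm a < R" "norm z \<le> q"
  shows "R\<^sup>2 - R * q \<le> norm (of_real (R\<^sup>2) - cnj a * z)"
proof -
  have "norm (cnj a * z) \<le> R * q"
    unfolding norm_mult using assms by (intro mult_mono) (auto intro: order.trans[OF norm_ge_zero less_imp_le])
  moreover have "norm (of_real (R\<^sup>2) :: complex) = R\<^sup>2" by (metis norm_of_real abs_power2)
  ultimately show ?thesis
    using norm_triangle_ineq2[of "of_real (R\<^sup>2)" "cnj a * z"] by linarith
qed

lemma blaschke_denom_nz:
  assumes "norm a < R" "norm z \<le> R"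
  shows "of_real (R\<^sup>2) - cnj a * z \<noteq> 0"
proof
  assume "of_real (R\<^sup>2) - cnj a * z = 0"
  hence "norm (of_real (R\<^sup>2) :: complex) = norm (cnj a * z)" by simp
  hence *: "R * R = norm a * norm z" by (simp add: norm_mult norm_power power2_eq_square)
  have "0 < R" using assms by (meson norm_ge_zero order.strict_trans1)
  have "norm a * norm z \<le> norm a * R" using assms by (intro mult_left_mono) auto
  also have "\<dots> < R * R" using assms \<open>0 < R\<close> by simp
  finally have "norm a * norm z < R * R" .
  thus False using * by simp
qed

lemma norm_blaschke_boundary:
  assumes "norm a < R" "norm z = R"
  shows "norm (blaschke R a z) = 1"
proof -
  have R: "0 < R" using assms by (meson norm_ge_zero order.strict_trans1)
  have "of_real (R\<^sup>2) = z * cnj z" using complex_norm_square[of z] assms by simp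
  hence "of_real (R\<^sup>2) - cnj a * z = z * cnj (z - a)" by (simp add: algebra_simps)
  moreover have "z \<noteq> a" using assms by auto
  ultimately show ?thesis using R assms(2)
    by (simp only: blaschke_def norm_divide norm_mult complex_mod_cnj) simp
qed

lemma blaschke_analytic:
  assumes "norm a < R" "norm z \<le> R"
  shows "blaschke R a analytic_on {z}"
  unfolding blaschke_def[abs_def] using blaschke_denom_nz[OF assms]
  by (intro analytic_intros) auto

lemma blaschke_eq_0_iff: "norm a < R \<Longrightarrow> norm z \<le> R \<Longrightarrow> blaschke R a z = 0 \<longleftrightarrow> z = a"
  using blaschke_denom_nz[of a R z] norm_ge_zero[of a] by (auto simp: blaschke_def simp del: norm_ge_zero)

lemma zorder_blaschke:
  assumes "norm a < R" "norm z \<le> R"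
  shows "zorder (blaschke R a) z = (if z = a then 1 else 0)"
proof (cases "z = a")
  case True
  define S where "S = {w. of_real (R\<^sup>2) - cnj a * w \<noteq> 0}"
  have "R \<noteq> 0" using assms norm_ge_zero[of a] by linarith
  have "zorder (blaschke R a) a = 1"
  proof (rule zorder_eqI)
    show "open S" unfolding S_def by (intro open_Collect_neq continuous_intros)
    show "a \<in> S" using blaschke_denom_nz[OF assms] True by (simp add: S_def)
    show "(\<lambda>w. of_real R / (of_real (R\<^sup>2) - cnj a * w)) holomorphic_on S"
      by (intro holomorphic_intros) (auto simp: S_def)
    show "of_real R / (of_real (R\<^sup>2) - cnj a * a) \<noteq> 0"
      using blaschke_denom_nz[OF assms] True \<open>R \<noteq> 0\<close> by simp
  qed (simp add: blaschke_def)
  thus ?thesis using True by simp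
next
  case False
  have "blaschke R a z \<noteq> 0" using blaschke_eq_0_iff[OF assms] False by simp
  hence "zorder (blaschke R a) z = 0"
    using blaschke_analytic[OF assms]
    by (metis analytic_at_neq_imp_eventually_neq at_neq_bot eventually_frequently zorder_eq_0_iff)
  thus ?thesis using False by simp
qed

lemma blaschke_eventually_nz:
  assumes "norm a < R" "norm z \<le> R"
  shows "\<forall>\<^sub>F w in at z. blaschke R a w \<noteq> 0"
proof (cases "z = a")
  case False
  thus ?thesis using blaschke_eq_0_iff[OF assms] blaschke_analytic[OF assms]
    by (metis analytic_at_neq_imp_eventually_neq)
next
  case True
  have "\<forall>\<^sub>F w in at a. w \<in> ball 0 R - {a}"
    by (rule eventually_at_in_open) (use assms in auto)
  thus ?thesis unfolding True
    by eventually_elim (use blaschke_eq_0_iff[OF assms(1)] in auto)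
qed

section \<open>Zeros and poles of a meromorphic function\<close>

locale nonzero_meromorphic =
  fixes f :: "complex \<Rightarrow> complex"
  assumes mero: "f meromorphic_on UNIV" and not_const_zero: "\<not> (\<forall>\<^sub>\<approx>x. f x = 0)"
begin

text \<open>Besides zeros and poles this contains the points at which the representing total
  function carries an irrelevant value. Off this set f is analytic and nonzero, so its logarithm has
  its usual meaning.\<close>

definition exceptional :: "complex set" where
  "exceptional = {x. \<not> f analytic_on {x} \<or> f x = 0}"

lemma sparse_exceptional: "exceptional sparse_in UNIV"
proof -
  have "\<forall>\<^sub>\<approx>x\<in>UNIV. f x \<noteq> 0"
    using meromorphic_imp_constant_or_avoid[OF mero] not_const_zero by auto
  moreover have "\<forall>\<^sub>\<approx>x\<in>UNIV. f analytic_on {x}"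
    using mero by (rule meromorphic_on_imp_analytic_cosparse)
  ultimately have "\<forall>\<^sub>\<approx>x\<in>UNIV. x \<notin> exceptional"
    by eventually_elim (auto simp: exceptional_def)
  thus ?thesis by (simp add: eventually_cosparse)
qed

lemma finite_exceptional: "finite (exceptional \<inter> cball 0 R)"
  by (metis sparse_exceptional compact_cball inf_commute sparse_in_compact_finite sparse_in_subset top_greatest)

lemma eventually_nz: "\<forall>\<^sub>F w in at z. f w \<noteq> 0"
proof -
  have "\<forall>\<^sub>\<approx>x\<in>UNIV. x \<notin> exceptional"
    using sparse_exceptional by (simp add: eventually_cosparse)
  hence "\<forall>\<^sub>F w in at z. w \<notin> exceptional" by (rule eventually_cosparse_imp_eventually_at) auto
  thus ?thesis by eventually_elim (auto simp: exceptional_def)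
qed

lemma frequently_nz: "\<exists>\<^sub>F w in at z. f w \<noteq> 0"
  using eventually_nz by (simp add: eventually_frequently)

lemma mero_at: "f meromorphic_on {z}"
  using mero by (rule meromorphic_on_subset) auto

lemma zorder_nz_imp_exceptional: "zorder f z \<noteq> 0 \<Longrightarrow> z \<in> exceptional"
  using frequently_nz zorder_eq_0_iff[of f z] by (auto simp: exceptional_def)

text \<open>The order depends on f in a punctured neighbourhood only, so irrelevant values do not
  enter here: the set consists of the true zeros and poles in the open disc.\<close>

definition div_support :: "real \<Rightarrow> complex set" where
  "div_support R = {a. norm a < R \<and> zorder f a \<noteq> 0}"

lemma finite_div_support: "finite (div_support R)"
  by (rule finite_subset[OF _ finite_exceptional[of R]]) (auto simp: div_support_def zorder_nz_imp_exceptional)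

text \<open>Dividing by Blaschke factors rather than by linear ones leaves \<open>\<bar>f\<bar>\<close> unchanged on the
  circle of radius \<open>R\<close>.\<close>

lemma blaschke_factorization:
  assumes R: "R > 0" and good: "\<And>x. norm x = R \<Longrightarrow> x \<notin> exceptional"
  obtains R' G where "R' > R" "G holomorphic_on ball 0 R'"
    "\<And>x. norm x \<le> R \<Longrightarrow> x \<notin> exceptional \<Longrightarrow> f x = exp (G x) * (\<Prod>a\<in>div_support R. blaschke R a x powi zorder f a)"
    "\<forall>\<^sub>F x in at 0. f x = exp (G x) * (\<Prod>a\<in>div_support R. blaschke R a x powi zorder f a)"
proof -
  define S where "S = div_support R"
  have S: "finite S" "\<And>a. a \<in> S \<Longrightarrow> norm a < R"
    using finite_div_support by (auto simp: S_def div_support_def)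
  define p where "p x = (\<Prod>a\<in>S. blaschke R a x powi (- zorder f a))" for x
  define g0 where "g0 x = f x * p x" for x
  have fac_mero: "(\<lambda>x. blaschke R a x powi n) meromorphic_on {z}" if "a \<in> S" "norm z \<le> R" for a z n
    by (intro meromorphic_intros analytic_on_imp_meromorphic_on blaschke_analytic) (use S that in auto)
  have p_mero: "p meromorphic_on {z}" if "norm z \<le> R" for z
    unfolding p_def by (intro meromorphic_on_prod fac_mero that)
  have p_nz: "\<forall>\<^sub>F w in at z. p w \<noteq> 0" if "norm z \<le> R" for z
  proof -
    have "\<forall>\<^sub>F w in at z. \<forall>a\<in>S. blaschke R a w \<noteq> 0"
      using S that by (auto simp: eventually_ball_finite_distrib intro!: blaschke_eventually_nz)
    thus ?thesis by eventually_elim (use S in \<open>auto simp: p_def\<close>)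
  qed
  have p_zorder: "zorder p z = - zorder f z" if z: "norm z \<le> R" for z
  proof -
    have "zorder p z = (\<Sum>a\<in>S. zorder (\<lambda>x. blaschke R a x powi (- zorder f a)) z)"
      unfolding p_def by (rule zorder_prod) (use fac_mero z p_nz[OF z] in \<open>auto simp: p_def\<close>)
    also have "\<dots> = (\<Sum>a\<in>S. if z = a then - zorder f z else 0)"
    proof (rule sum.cong)
      fix a assume a: "a \<in> S"
      have "zorder (\<lambda>x. blaschke R a x powi (- zorder f a)) z = - zorder f a * zorder (blaschke R a) z"
        by (rule zorder_power_int) (use a S z blaschke_eventually_nz[of a R z] in
            \<open>auto intro!: analytic_on_imp_meromorphic_on blaschke_analytic simp: eventually_frequently\<close>)
      thus "zorder (\<lambda>x. blaschke R a x powi (- zorder f a)) z = (if z = a then - zorder f z else 0)"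
        using zorder_blaschke[of a R z] a S z by simp
    qed simp
    also have "\<dots> = - zorder f z"
    proof (cases "z \<in> S")
      case False
      hence "norm z = R \<or> zorder f z = 0" using z by (auto simp: S_def div_support_def)
      \<comment> \<open>The factors are taken over the open disc only; on its circle
        \<open>good\<close> excludes zeros and poles.\<close>
      hence "zorder f z = 0" using good zorder_nz_imp_exceptional by blast
      thus ?thesis using S by simp
    qed (use S in simp)
    finally show ?thesis .
  qed
  have g0_mero: "g0 meromorphic_on {z}" if "norm z \<le> R" for z
    unfolding g0_def by (intro meromorphic_intros mero_at p_mero that)
  have g0_nz: "\<forall>\<^sub>F w in at z. g0 w \<noteq> 0" if "norm z \<le> R" for z
    using eventually_nz[of z] p_nz[OF that] by eventually_elim (auto simp: g0_def)
  have g0_zorder: "zorder g0 z = 0" if z: "norm z \<le> R" for z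
    unfolding g0_def
    by (subst zorder_mult) (use p_zorder[OF z] p_mero[OF z] mero_at frequently_nz eventually_frequently[OF _ p_nz[OF z]] in auto)
  \<comment> \<open>As \<open>g0\<close> has order 0 throughout the closed disc, it has a finite
    nonzero limit at each point. Its continuation \<open>g\<close> is analytic without zeros there,
    hence also on a slightly larger disc, where it has a logarithm.\<close>
  define g where "g = remove_sings g0"
  have g: "g analytic_on {z}" "g z \<noteq> 0" if z: "norm z \<le> R" for z
  proof -
    have iso: "isolated_singularity_at g0 z" and ness: "not_essential g0 z"
      using g0_mero[OF z] by (auto simp: meromorphic_at_iff)
    have "\<not> is_pole g0 z"
      using g0_zorder[OF z] isolated_pole_imp_neg_zorder[OF iso] by force
    then obtain c where c: "g0 \<midarrow>z\<rightarrow> c"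
      using ness by (auto simp: not_essential_def)
    have "\<not> isolated_zero g0 z"
      using g0_zorder[OF z] zorder_isolated_zero_pos'[OF _ iso] by force
    hence "c \<noteq> 0" using c g0_nz[OF z] by (auto simp: isolated_zero_def)
    thus "g z \<noteq> 0" using remove_sings_eqI[OF c] by (simp add: g_def)
    show "g analytic_on {z}"
      unfolding g_def by (rule remove_sings_analytic_at[OF iso c])
  qed
  obtain T where T: "open T" "cball 0 R \<subseteq> T" "g holomorphic_on T"
  proof -
    have "g analytic_on cball 0 R" using g(1) by (subst analytic_on_analytic_at) auto
    thus ?thesis using that by (auto simp: analytic_on_holomorphic)
  qed
  define T' where "T' = T \<inter> g -` (- {0})"
  have T'o: "open T'" unfolding T'_def
    by (rule continuous_open_preimage[OF holomorphic_on_imp_continuous_on[OF T(3)] T(1)]) auto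
  have T's: "cball 0 R \<subseteq> T'" using T g by (auto simp: T'_def)
  obtain e where e: "e > 0" "(\<Union>x\<in>cball 0 R. ball x e) \<subseteq> T'"
    using compact_subset_open_imp_ball_epsilon_subset[OF compact_cball T'o T's] by metis
  define R' where "R' = R + e"
  have sub: "ball 0 R' \<subseteq> T'"
  proof
    fix x :: complex assume x: "x \<in> ball 0 R'"
    show "x \<in> T'"
    proof (cases "norm x \<le> R")
      case True thus ?thesis using T's by auto
    next
      case False
      \<comment> \<open>The radial projection of x to the circle of radius R; x lies within
        \<open>e\<close> of it.\<close>
      define y where "y = of_real (R / norm x) * x"
      have "norm x > 0" using False R by linarith
      hence "norm y = R" using R by (simp add: y_def norm_mult norm_divide)
      have "norm (y - x) < e"
      proof -
        have "y - x = of_real (R / norm x - 1) * x" by (simp add: y_def algebra_simps)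
        hence "norm (y - x) = \<bar>R / norm x - 1\<bar> * norm x" by (simp only: norm_mult norm_of_real)
        also have "\<dots> = norm x - R" using False R \<open>norm x > 0\<close> by (simp add: abs_if field_simps)
        finally show ?thesis using x by (simp add: R'_def)
      qed
      thus ?thesis using e \<open>norm y = R\<close> by (auto simp: dist_norm intro!: subsetD[OF e(2)] bexI[of _ y])
    qed
  qed
  obtain G where G: "G holomorphic_on ball 0 R'" "\<And>x. x \<in> ball 0 R' \<Longrightarrow> exp (G x) = g x"
  proof (rule holomorphic_logarithm_exists[of "ball 0 R'" g 0])
    show "g holomorphic_on ball 0 R'"
      by (rule holomorphic_on_subset[OF T(3)]) (use sub in \<open>auto simp: T'_def\<close>)
  qed (use sub R e that in \<open>auto simp: R'_def T'_def\<close>)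
  have p1: "p x * (\<Prod>a\<in>S. blaschke R a x powi zorder f a) = 1" if "\<forall>a\<in>S. blaschke R a x \<noteq> 0" for x
    using that by (simp add: p_def power_int_minus flip: prod.distrib)
  show ?thesis
  proof (rule that[of R' G])
    fix x assume x: "norm x \<le> R" "x \<notin> exceptional"
    hence xS: "x \<notin> S" using zorder_nz_imp_exceptional by (auto simp: S_def div_support_def)
    have b: "\<forall>a\<in>S. blaschke R a x \<noteq> 0" using blaschke_eq_0_iff S x xS by blast
    have "(\<lambda>x. blaschke R a x powi n) analytic_on {x}" if "a \<in> S" for a n
      by (intro analytic_intros blaschke_analytic) (use S x b that in auto)
    hence "g0 analytic_on {x}"
      unfolding g0_def p_def using x by (intro analytic_on_mult analytic_on_prod) (auto simp: exceptional_def)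
    hence "exp (G x) = g0 x" using G(2)[of x] x e by (simp add: R'_def g_def)
    thus "f x = exp (G x) * (\<Prod>a\<in>div_support R. blaschke R a x powi zorder f a)"
      using p1[OF b] by (simp add: g0_def S_def[symmetric] mult.assoc)
  next
    \<comment> \<open>Jensen's formula needs the factorization near 0, and 0 may itself be
      exceptional; hence the version in a punctured neighbourhood.\<close>
    have "\<forall>\<^sub>F x in at 0. \<forall>a\<in>S. blaschke R a x \<noteq> 0"
      using S R by (auto simp: eventually_ball_finite_distrib intro!: blaschke_eventually_nz)
    moreover have "\<forall>\<^sub>F x in at 0. x \<in> ball 0 R' - {0}"
      by (rule eventually_at_in_open) (use R e in \<open>auto simp: R'_def\<close>)
    moreover have "\<forall>\<^sub>F x in at 0. g x = g0 x"
      unfolding g_def using g0_mero[of 0] R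
      by (intro eventually_remove_sings_eq_at) (auto simp: meromorphic_at_iff)
    ultimately show "\<forall>\<^sub>F x in at 0. f x = exp (G x) * (\<Prod>a\<in>div_support R. blaschke R a x powi zorder f a)"
    proof eventually_elim
      case (elim x)
      thus ?case using p1[of x] G(2)[of x] by (simp add: g0_def S_def[symmetric] mult.assoc)
    qed
  qed (use e G in \<open>auto simp: R'_def\<close>)
qed

end

section \<open>Jensen's formula and the counting function\<close>

lemma ln_powi: "x > 0 \<Longrightarrow> ln (x powi n) = of_int n * ln (x :: real)"
  by (metis ln_powr powr_real_of_int' less_imp_le less_irrefl)

text \<open>The contribution of a single pole of modulus \<open>c\<close> to the integral in the
  counting function.\<close>

lemma has_integral_truncated_inverse:
  fixes c R :: real
  assumes "0 < c" "c \<le> R"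
  shows "((\<lambda>t. if c \<le> t then 1 / t else 0) has_integral ln (R / c)) {0..R}"
proof -
  have "((\<lambda>t. 1 / t) has_integral (ln R - ln c)) {c..R}"
    using assms by (intro fundamental_theorem_of_calculus)
      (auto intro!: derivative_eq_intros simp flip: has_real_derivative_iff_has_vector_derivative)
  hence "((\<lambda>t. if t \<in> {c..R} then 1 / t else 0) has_integral (ln R - ln c)) {0..R}"
    using assms by (subst has_integral_restrict) auto
  hence "((\<lambda>t. if c \<le> t then 1 / t else 0) has_integral (ln R - ln c)) {0..R}"
    by (rule has_integral_eq[rotated]) auto
  thus ?thesis using assms by (simp add: ln_div)
qed

context nonzero_meromorphic
begin

lemma pole_mult_eq: "pole_mult f a = nat (- zorder f a)"
  using zorder_neg_imp_is_pole[OF mero_at eventually_nz] by (force simp: pole_mult_def)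

text \<open>Summation and integration are exchanged, which gives the form of the counting function
  that matches Jensen's formula. \<open>good\<close> reconciles the closed disc in
  \<open>pole_count\<close> with the open one in \<open>div_support\<close>.\<close>

lemma counting_eq:
  assumes R: "R > 0" and good: "\<And>x. norm x = R \<Longrightarrow> x \<notin> exceptional"
  shows "counting R f = (\<Sum>a\<in>div_support R - {0}. real (nat (- zorder f a)) * ln (R / norm a))
           + real (nat (- zorder f 0)) * ln R"
proof -
  define S where "S = div_support R - {0}"
  have S: "finite S" "\<And>a. a \<in> S \<Longrightarrow> 0 < norm a \<and> norm a < R"
    using finite_div_support by (auto simp: S_def div_support_def)
  have count: "pole_count t f = (\<Sum>a\<in>S. if norm a \<le> t then nat (- zorder f a) else 0) + nat (- zorder f 0)"
    if t: "0 \<le> t" "t \<le> R" for t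
  proof -
    have "pole_count t f = (\<Sum>a\<in>{a \<in> insert 0 S. norm a \<le> t}. nat (- zorder f a))"
      unfolding pole_count_def pole_mult_eq
    proof (rule sum.mono_neutral_cong_left)
      show "finite {a \<in> insert 0 S. norm a \<le> t}" using S by simp
      show "{z. norm z \<le> t \<and> is_pole f z} \<subseteq> {a \<in> insert 0 S. norm a \<le> t}"
      proof
        fix a assume "a \<in> {z. norm z \<le> t \<and> is_pole f z}"
        hence a: "norm a \<le> t" "is_pole f a" by auto
        have "zorder f a < 0"
          using a(2) isolated_pole_imp_neg_zorder mero_at meromorphic_at_iff by blast
        hence "norm a \<noteq> R" using good zorder_nz_imp_exceptional by force
        thus "a \<in> {a \<in> insert 0 S. norm a \<le> t}" using a t \<open>zorder f a < 0\<close> by (auto simp: S_def div_support_def)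
      qed
      show "\<forall>i\<in>{a \<in> insert 0 S. norm a \<le> t} - {z. norm z \<le> t \<and> is_pole f z}. nat (- zorder f i) = 0"
        by (auto simp flip: pole_mult_eq simp: pole_mult_def)
    qed simp
    also have "\<dots> = (\<Sum>a\<in>insert 0 S. if norm a \<le> t then nat (- zorder f a) else 0)"
      using S by (subst sum.inter_filter) auto
    also have "\<dots> = (\<Sum>a\<in>S. if norm a \<le> t then nat (- zorder f a) else 0) + nat (- zorder f 0)"
      using S t by (subst sum.insert) (auto simp: S_def)
    finally show ?thesis .
  qed
  have "pole_count 0 f = nat (- zorder f 0)"
    using count[of 0] R S by (auto intro!: sum.neutral)
  moreover have "((\<lambda>t. (real (pole_count t f) - real (pole_count 0 f)) / t) has_integral
      (\<Sum>a\<in>S. real (nat (- zorder f a)) * ln (R / norm a))) {0..R}"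
  proof (rule has_integral_eq[rotated])
    show "((\<lambda>t. \<Sum>a\<in>S. real (nat (- zorder f a)) * (if norm a \<le> t then 1 / t else 0)) has_integral
      (\<Sum>a\<in>S. real (nat (- zorder f a)) * ln (R / norm a))) {0..R}"
      by (intro has_integral_sum has_integral_mult_right has_integral_truncated_inverse)
         (use S in \<open>auto intro: less_imp_le\<close>)
    fix t assume "t \<in> {0..R}"
    hence "real (pole_count t f) - real (pole_count 0 f) = (\<Sum>a\<in>S. real (nat (- zorder f a)) * (if norm a \<le> t then 1 else 0))"
      using \<open>pole_count 0 f = nat (- zorder f 0)\<close> by (simp add: count if_distrib cong: if_cong)
    thus "(\<Sum>a\<in>S. real (nat (- zorder f a)) * (if norm a \<le> t then 1 / t else 0)) =
        (real (pole_count t f) - real (pole_count 0 f)) / t"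
      by (simp only: sum_divide_distrib) (intro sum.cong, auto)
  qed
  ultimately show ?thesis
    unfolding counting_def S_def[symmetric] by (simp add: integral_unique)
qed

text \<open>The logarithm of the modulus of the first nonzero Laurent coefficient at 0. It replaces
  ln \<bar>f 0\<bar> in Jensen's formula, so that a zero or pole at the origin is permitted.\<close>

definition leading_log :: real where
  "leading_log = ln (norm (zor_poly f 0 0))"

text \<open>At 0 the Blaschke factor of a has modulus \<bar>a\<bar> / R, and the factor of the
  origin is x / R, whose power of x cancels against that of the Laurent expansion. Comparing limits
  at 0 gives Jensen's formula, with the boundary mean of ln \<bar>f\<bar> written as Re (G
  0).\<close>

lemma jensen_center:
  assumes R: "R > 0" and G: "isCont G 0"
    and f_eq: "\<forall>\<^sub>F x in at 0. f x = exp (G x) * (\<Prod>a\<in>div_support R. blaschke R a x powi zorder f a)"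
  shows "Re (G 0) = leading_log + of_int (zorder f 0) * ln R
           + (\<Sum>a\<in>div_support R - {0}. of_int (zorder f a) * ln (R / norm a))"
proof -
  define m where "m = zorder f 0"
  define h where "h = zor_poly f 0"
  define S where "S = div_support R - {0}"
  have S: "finite S" "\<And>a. a \<in> S \<Longrightarrow> 0 < norm a \<and> norm a < R"
    using finite_div_support by (auto simp: S_def div_support_def)
  obtain e where e: "e > 0" "h 0 \<noteq> 0" "h holomorphic_on cball 0 e"
    "\<forall>w\<in>cball 0 e - {0}. f w = h w * (w - 0) powi m"
    using zorder_exist[of f 0] mero_at frequently_nz unfolding m_def h_def
    by (auto simp: meromorphic_at_iff)
  have "\<forall>\<^sub>F x in at 0. x \<in> ball 0 e - {0::complex}"
    by (rule eventually_at_in_open) (use e in auto)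
  with f_eq have ev: "\<forall>\<^sub>F x in at 0. exp (G x) * (1 / of_real R) powi m * (\<Prod>a\<in>S. blaschke R a x powi zorder f a) = h x"
  proof eventually_elim
    case (elim x)
    have "(\<Prod>a\<in>div_support R. blaschke R a x powi zorder f a) = blaschke R 0 x powi m * (\<Prod>a\<in>S. blaschke R a x powi zorder f a)"
    proof (cases "0 \<in> div_support R")
      case True
      thus ?thesis unfolding S_def m_def by (rule prod.remove[OF finite_div_support])
    next
      case False
      hence "m = 0" using R by (auto simp: div_support_def m_def)
      thus ?thesis using False by (simp add: S_def)
    qed
    moreover have "blaschke R 0 x powi m = (1 / of_real R) powi m * x powi m"
      using R by (simp add: blaschke_def power2_eq_square flip: power_int_mult_distrib)
    ultimately show ?case using elim e(4) by auto
  qed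
  have c: "isCont h 0"
    using e by (intro continuous_on_interior[OF holomorphic_on_imp_continuous_on[OF e(3)]]) auto
  have "((\<lambda>x. exp (G x) * (1 / of_real R) powi m * (\<Prod>a\<in>S. blaschke R a x powi zorder f a)) \<longlongrightarrow>
     exp (G 0) * (1 / of_real R) powi m * (\<Prod>a\<in>S. blaschke R a 0 powi zorder f a)) (at 0)"
    using S R by (intro tendsto_intros tendsto_power_int isContD[OF G] isContD[OF analytic_at_imp_isCont] blaschke_analytic)
       (auto simp: blaschke_eq_0_iff)
  moreover have "((\<lambda>x. exp (G x) * (1 / of_real R) powi m * (\<Prod>a\<in>S. blaschke R a x powi zorder f a)) \<longlongrightarrow> h 0) (at 0)"
    using isContD[OF c] by (rule Lim_transform_eventually) (use ev in \<open>auto elim: eventually_mono\<close>)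
  ultimately have "h 0 = exp (G 0) * (1 / of_real R) powi m * (\<Prod>a\<in>S. blaschke R a 0 powi zorder f a)"
    using LIM_unique by blast
  hence "norm (h 0) = exp (Re (G 0)) * (1 / R) powi m * (\<Prod>a\<in>S. (norm a / R) powi zorder f a)"
    using R by (simp add: norm_mult norm_power_int norm_divide blaschke_def power2_eq_square flip: prod_norm)
  hence "ln (norm (h 0)) = Re (G 0) + ln ((1 / R) powi m) + ln (\<Prod>a\<in>S. (norm a / R) powi zorder f a)"
    using R S by (simp add: ln_mult prod_pos less_imp_neq[symmetric] prod_zero_iff)
  also have "ln (\<Prod>a\<in>S. (norm a / R) powi zorder f a) = (\<Sum>a\<in>S. ln ((norm a / R) powi zorder f a))"
    using R S by (intro ln_prod) auto
  also have "\<dots> = - (\<Sum>a\<in>S. of_int (zorder f a) * ln (R / norm a))"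
    unfolding sum_negf[symmetric] using R S by (intro sum.cong) (auto simp: ln_powi ln_div algebra_simps)
  also have "ln ((1 / R) powi m) = - of_int m * ln R"
    using R by (simp add: ln_powi ln_div)
  finally show ?thesis
    by (simp add: leading_log_def h_def S_def m_def)
qed

end

section \<open>Pointwise estimates of logarithmic quotients\<close>

lemma ln_plus_exp: "ln_plus (exp u) = max 0 u"
  by (auto simp: ln_plus_def max_def)

lemma ln_plus_nonneg: "0 \<le> ln_plus x"
  by (simp add: ln_plus_def)

lemma proximity_nonneg: "0 \<le> proximity r g"
proof -
  have "0 \<le> integral {0..2 * pi} (\<lambda>\<theta>. ln_plus (cmod (g (of_real r * exp (\<i> * of_real \<theta>)))))"
    using integral_nonneg[of "\<lambda>\<theta>. ln_plus (cmod (g (of_real r * exp (\<i> * of_real \<theta>))))" "{0..2*pi}"]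
    by (cases "(\<lambda>\<theta>. ln_plus (cmod (g (of_real r * exp (\<i> * of_real \<theta>))))) integrable_on {0..2*pi}")
       (auto simp: ln_plus_nonneg not_integrable_integral)
  thus ?thesis by (simp add: proximity_def)
qed

section \<open>Differences of logarithms\<close>

lemma ln_1_plus_le_powr:
  fixes t \<alpha> :: real
  assumes "0 < \<alpha>" "\<alpha> \<le> 1" "0 \<le> t"
  shows "ln (1 + t) \<le> 2 / \<alpha> * t powr \<alpha>"
proof (cases "t \<le> 1")
  case True
  have "t \<le> t powr \<alpha>"
    using powr_mono'[of \<alpha> 1 t] assms True by (cases "t = 0") auto
  moreover have "1 \<le> 2 / \<alpha>" using assms by (simp add: field_simps)
  ultimately have "t \<le> 2 / \<alpha> * t powr \<alpha>"
    using mult_mono[of 1 "2/\<alpha>" t "t powr \<alpha>"] assms by simp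
  thus ?thesis using ln_add_one_self_le_self[OF assms(3)] by linarith
next
  case False
  have "ln (1 + t) \<le> ln (2 * t)" using False by simp
  also have "\<dots> = ln 2 + ln t" using False by (simp add: ln_mult)
  also have "ln t \<le> t powr \<alpha> / \<alpha>" using False assms by (intro ln_powr_bound) auto
  also have "ln 2 \<le> (1::real)" using ln_le_minus_one[of 2] by simp
  also have "1 \<le> t powr \<alpha> / \<alpha>"
    using ge_one_powr_ge_zero[of t \<alpha>] assms False by (simp add: field_simps)
  finally show ?thesis by simp
qed

text \<open>For distances u and v to a zero or pole, which may be arbitrarily small. The bound ln (1
  + d / v) \<le> d / v would be singular of order 1 in v; lowering the power to \<alpha> < 1 makes
  it integrable.\<close>

lemma abs_ln_diff_le_powr:
  fixes u v d \<alpha> :: real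
  assumes "0 < u" "0 < v" "\<bar>u - v\<bar> \<le> d" "0 < \<alpha>" "\<alpha> \<le> 1"
  shows "\<bar>ln u - ln v\<bar> \<le> 2 / \<alpha> * d powr \<alpha> * (u powr - \<alpha> + v powr - \<alpha>)"
proof -
  have *: "ln u - ln v \<le> 2 / \<alpha> * d powr \<alpha> * v powr - \<alpha>" if "0 < u" "0 < v" "u - v \<le> d" "0 \<le> d" for u v
  proof -
    have "ln u - ln v = ln (u / v)" using that by (simp add: ln_div)
    also have "\<dots> \<le> ln (1 + d / v)"
      using that by (subst ln_le_cancel_iff) (auto simp: field_simps add_pos_nonneg)
    also have "\<dots> \<le> 2 / \<alpha> * (d / v) powr \<alpha>" using that assms by (intro ln_1_plus_le_powr) auto
    also have "(d / v) powr \<alpha> = d powr \<alpha> * v powr - \<alpha>"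
      using that by (simp add: powr_divide powr_minus field_simps)
    finally show ?thesis by simp
  qed
  have d: "0 \<le> d" using assms(3) by linarith
  have "ln u - ln v \<le> 2 / \<alpha> * d powr \<alpha> * v powr - \<alpha>" "ln v - ln u \<le> 2 / \<alpha> * d powr \<alpha> * u powr - \<alpha>"
    using *[of u v] *[of v u] assms d by auto
  moreover have "0 \<le> 2 / \<alpha> * d powr \<alpha> * v powr - \<alpha>" "0 \<le> 2 / \<alpha> * d powr \<alpha> * u powr - \<alpha>"
    using assms by auto
  ultimately show ?thesis unfolding distrib_left by linarith
qed

text \<open>For quantities bounded away from 0, where the gain is linear in d. It serves the
  Blaschke denominators.\<close>

lemma abs_ln_diff_le:
  fixes u v d m :: real
  assumes "0 < m" "m \<le> u" "m \<le> v" "\<bar>u - v\<bar> \<le> d"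
  shows "\<bar>ln u - ln v\<bar> \<le> d / m"
proof -
  have *: "ln u - ln v \<le> d / m" if "m \<le> u" "m \<le> v" "u - v \<le> d" "0 \<le> d" for u v
  proof -
    have "ln u - ln v = ln (u / v)" using that assms by (simp add: ln_div)
    also have "\<dots> \<le> u / v - 1" using that assms by (intro ln_le_minus_one) auto
    also have "\<dots> = (u - v) / v" using that assms by (simp add: field_simps)
    also have "\<dots> \<le> d / v" using that assms by (intro divide_right_mono) auto
    also have "\<dots> \<le> d / m" using that assms by (intro divide_left_mono) auto
    finally show ?thesis .
  qed
  have "ln u - ln v \<le> d / m" "ln v - ln u \<le> d / m" using *[of u v] *[of v u] assms by auto
  thus ?thesis by linarith
qed

lemma ln_norm_blaschke:
  assumes "0 < R" "norm a < R" "norm x \<le> R" "x \<noteq> a"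
  shows "ln (norm (blaschke R a x)) = ln R + ln (norm (x - a)) - ln (norm (of_real (R\<^sup>2) - cnj a * x))"
  unfolding blaschke_def norm_divide norm_mult
  using assms blaschke_denom_nz[OF assms(2,3)] by (simp add: ln_mult ln_div)

text \<open>Numerator and denominator are treated separately. In the disc of radius 3R/4 the
  denominator is at least R^2/4 and moves by at most R * d, whence 4 * d / R; only the numerator can
  be small.\<close>

lemma ln_blaschke_diff:
  fixes \<alpha> :: real
  assumes R: "0 < R" "norm a < R" and x: "norm x \<le> 3 * R / 4" "x \<noteq> a" and w: "norm w \<le> 3 * R / 4" "w \<noteq> a"
    and \<alpha>: "0 < \<alpha>" "\<alpha> \<le> 1" and d: "norm (w - x) \<le> d"
  shows "\<bar>ln (norm (blaschke R a w)) - ln (norm (blaschke R a x))\<bar> \<le>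
     4 * d / R + 2 / \<alpha> * d powr \<alpha> * (norm (w - a) powr - \<alpha> + norm (x - a) powr - \<alpha>)"
proof -
  define p q where "p = norm (of_real (R\<^sup>2) - cnj a * w)" and "q = norm (of_real (R\<^sup>2) - cnj a * x)"
  have "\<bar>ln p - ln q\<bar> \<le> (R * d) / (R\<^sup>2 - R * (3 * R / 4))"
  proof (rule abs_ln_diff_le)
    show "0 < R\<^sup>2 - R * (3 * R / 4)" using R by (simp add: power2_eq_square)
    show "R\<^sup>2 - R * (3 * R / 4) \<le> p" "R\<^sup>2 - R * (3 * R / 4) \<le> q"
      unfolding p_def q_def by (intro blaschke_denom_ge R x w)+
    have "\<bar>p - q\<bar> \<le> norm ((of_real (R\<^sup>2) - cnj a * w) - (of_real (R\<^sup>2) - cnj a * x))"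
      unfolding p_def q_def by (rule norm_triangle_ineq3)
    also have "\<dots> = norm (cnj a * (x - w))" by (simp add: algebra_simps)
    also have "\<dots> \<le> R * d"
      unfolding norm_mult using R d by (intro mult_mono) (auto simp: norm_minus_commute)
    finally show "\<bar>p - q\<bar> \<le> R * d" .
  qed
  also have "\<dots> = 4 * d / R" using R by (simp add: power2_eq_square field_simps)
  finally have 1: "\<bar>ln p - ln q\<bar> \<le> 4 * d / R" .
  have "\<bar>norm (w - a) - norm (x - a)\<bar> \<le> norm ((w - a) - (x - a))" by (rule norm_triangle_ineq3)
  hence 2: "\<bar>ln (norm (w - a)) - ln (norm (x - a))\<bar> \<le> 2 / \<alpha> * d powr \<alpha> * (norm (w - a) powr - \<alpha> + norm (x - a) powr - \<alpha>)"
    using x w d \<alpha> by (intro abs_ln_diff_le_powr) auto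
  have "ln (norm (blaschke R a w)) = ln R + ln (norm (w - a)) - ln p"
    "ln (norm (blaschke R a x)) = ln R + ln (norm (x - a)) - ln q"
    unfolding p_def q_def by (rule ln_norm_blaschke; use R x w in simp)+
  thus ?thesis using 1 2 by linarith
qed

context nonzero_meromorphic
begin

text \<open>Write u for Re G on the circle, where it equals ln \<bar>f\<bar>. Since \<bar>u\<bar> =
  2 max 0 u - u, the mean of \<bar>u\<bar> is 2 \<open>proximity R f\<close> - Re (G 0). By Jensen's
  formula Re (G 0) is \<open>leading_log\<close> plus the weighted zeros minus the weighted poles.
  Dropping the zeros bounds the mean; Re (G 0) \<le> \<open>proximity R f\<close> bounds the zeros,
  and the poles are part of the characteristic.\<close>

lemma disc_estimates:
  assumes R: "R \<ge> 1" and good: "\<And>x. norm x = R \<Longrightarrow> x \<notin> exceptional"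
  obtains R' G where "R' > R" "G holomorphic_on ball 0 R'"
    "\<And>x. norm x \<le> R \<Longrightarrow> x \<notin> exceptional \<Longrightarrow> f x = exp (G x) * (\<Prod>a\<in>div_support R. blaschke R a x powi zorder f a)"
    "1 / (2 * pi) * integral {0..2*pi} (\<lambda>t. \<bar>Re (G (of_real R * exp (\<i> * of_real t)))\<bar>) \<le> 2 * characteristic R f - leading_log"
    "(\<Sum>a\<in>div_support R - {0}. real_of_int \<bar>zorder f a\<bar> * ln (R / norm a)) \<le> 2 * characteristic R f - leading_log"
proof -
  have R0: "R > 0" using R by simp
  obtain R' G where G: "R' > R" "G holomorphic_on ball 0 R'"
    "\<And>x. norm x \<le> R \<Longrightarrow> x \<notin> exceptional \<Longrightarrow> f x = exp (G x) * (\<Prod>a\<in>div_support R. blaschke R a x powi zorder f a)"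
    "\<forall>\<^sub>F x in at 0. f x = exp (G x) * (\<Prod>a\<in>div_support R. blaschke R a x powi zorder f a)"
    using blaschke_factorization[OF R0 good] by blast
  define u where "u t = Re (G (of_real R * exp (\<i> * of_real t)))" for t
  define S where "S = div_support R - {0}"
  have S: "finite S" "\<And>a. a \<in> S \<Longrightarrow> 0 < norm a \<and> norm a < R"
    using finite_div_support by (auto simp: S_def div_support_def)
  have contG: "continuous_on (ball 0 R') G" by (rule holomorphic_on_imp_continuous_on[OF G(2)])
  have Gc: "isCont G 0" using contG G(1) R0 by (intro continuous_on_interior[OF contG]) auto
  have cont: "continuous_on {0..2*pi} u"
    unfolding u_def by (intro continuous_intros continuous_on_compose2[OF contG]) (use R0 G(1) in \<open>auto simp: norm_mult\<close>)
  define I where "I = 1 / (2 * pi) * integral {0..2*pi} (\<lambda>t. \<bar>u t\<bar>)"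
  have prox: "proximity R f = 1 / (2 * pi) * integral {0..2*pi} (\<lambda>t. max 0 (u t))"
  proof -
    have "ln_plus (cmod (f (of_real R * exp (\<i> * of_real t)))) = max 0 (u t)" for t
    proof -
      define x where "x = of_real R * exp (\<i> * of_real t)"
      have nx: "norm x = R" using R0 by (simp add: x_def norm_mult)
      have "norm (\<Prod>a\<in>div_support R. blaschke R a x powi zorder f a) = 1"
        unfolding prod_norm[symmetric] norm_power_int
        by (intro prod.neutral ballI) (use norm_blaschke_boundary nx in \<open>auto simp: div_support_def\<close>)
      hence "norm (f x) = exp (u t)"
        using G(3)[of x] good nx by (simp add: norm_mult u_def x_def)
      thus ?thesis by (simp add: x_def ln_plus_exp)
    qed
    thus ?thesis by (simp add: proximity_def)
  qed
  have mean: "(u has_integral (2 * pi * Re (G 0))) {0..2*pi}"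
    unfolding u_def by (rule mean_value_Re[OF holomorphic_on_subset[OF G(2)] R0]) (use G(1) in auto)
  have i1: "(\<lambda>t. max 0 (u t)) integrable_on {0..2*pi}"
    by (intro integrable_continuous_interval continuous_intros cont)
  have I_eq: "I = 2 * proximity R f - Re (G 0)"
  proof -
    have "integral {0..2*pi} (\<lambda>t. \<bar>u t\<bar>) = integral {0..2*pi} (\<lambda>t. 2 * max 0 (u t) - u t)"
      by (intro integral_cong) auto
    also have "\<dots> = 2 * integral {0..2*pi} (\<lambda>t. max 0 (u t)) - 2 * pi * Re (G 0)"
      using i1 mean by (subst integral_diff) (auto intro!: integrable_on_mult_right simp: integral_unique)
    finally show ?thesis by (simp add: I_def prox field_simps)
  qed
  have G0: "Re (G 0) \<le> proximity R f"
  proof -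
    have "2 * pi * Re (G 0) \<le> integral {0..2*pi} (\<lambda>t. max 0 (u t))"
      by (rule has_integral_le[OF mean integrable_integral[OF i1]]) auto
    thus ?thesis by (simp add: prox field_simps)
  qed
  define Zr where "Zr = (\<Sum>a\<in>S. real (nat (zorder f a)) * ln (R / norm a))"
  define Po where "Po = (\<Sum>a\<in>S. real (nat (- zorder f a)) * ln (R / norm a))"
  define z0 p0 where "z0 = real (nat (zorder f 0)) * ln R" and "p0 = real (nat (- zorder f 0)) * ln R"
  have lnn: "0 \<le> ln (R / norm a)" if "a \<in> S" for a using S[of] S(2)[OF that] by simp
  \<comment> \<open>Here R \<ge> 1 enters: the contributions of the origin carry the factor ln
    R.\<close>
  have nn: "0 \<le> Zr" "0 \<le> Po" "0 \<le> z0" "0 \<le> p0"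
    using R lnn by (auto simp: Zr_def Po_def z0_def p0_def intro!: sum_nonneg)
  have N: "counting R f = Po + p0"
    unfolding Po_def p0_def S_def by (rule counting_eq[OF R0 good])
  have int_nat: "real_of_int k = real (nat k) - real (nat (- k))" "real_of_int \<bar>k\<bar> = real (nat k) + real (nat (- k))" for k
    by (auto simp: abs_if)
  have J: "Re (G 0) = leading_log + (z0 - p0) + (Zr - Po)"
    using jensen_center[OF R0 Gc G(4)]
    unfolding Zr_def Po_def z0_def p0_def S_def[symmetric] int_nat sum_subtractf[symmetric]
    by (simp add: left_diff_distrib)
  have T: "characteristic R f = proximity R f + Po + p0" by (simp add: characteristic_def N)
  show ?thesis
  proof (rule that[OF G(1,2,3)])
    show "1 / (2 * pi) * integral {0..2*pi} (\<lambda>t. \<bar>Re (G (of_real R * exp (\<i> * of_real t)))\<bar>) \<le> 2 * characteristic R f - leading_log"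
      using I_eq J nn T unfolding I_def u_def by linarith
    have "(\<Sum>a\<in>div_support R - {0}. real_of_int \<bar>zorder f a\<bar> * ln (R / norm a)) = Zr + Po"
      unfolding Zr_def Po_def S_def[symmetric] int_nat(2) by (simp only: sum.distrib distrib_right)
    also have "\<dots> \<le> 2 * characteristic R f - leading_log"
      using J nn T G0 proximity_nonneg[of R f] by linarith
    finally show "(\<Sum>a\<in>div_support R - {0}. real_of_int \<bar>zorder f a\<bar> * ln (R / norm a)) \<le> 2 * characteristic R f - leading_log" .
  qed
qed

text \<open>A zero or pole a \<noteq> 0 of modulus below R/2 has weight at least ln 2 in Jensen's
  sum. The origin does not occur in that sum and is counted separately.\<close>

lemma sum_abs_zorder_le:
  assumes R: "R \<ge> 1" and good: "\<And>x. norm x = R \<Longrightarrow> x \<notin> exceptional" and r: "2 * r \<le> R"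
  shows "(\<Sum>a\<in>div_support r. real_of_int \<bar>zorder f a\<bar>) \<le> real_of_int \<bar>zorder f 0\<bar> + (2 * characteristic R f - leading_log) / ln 2"
proof -
  have fin: "finite (div_support R)" "finite (div_support r)" by (rule finite_div_support)+
  have sub: "div_support r - {0} \<subseteq> div_support R - {0}" using r R by (auto simp: div_support_def)
  have "(\<Sum>a\<in>div_support r - {0}. real_of_int \<bar>zorder f a\<bar>) * ln 2 = (\<Sum>a\<in>div_support r - {0}. real_of_int \<bar>zorder f a\<bar> * ln 2)"
    by (rule sum_distrib_right)
  also have "\<dots> \<le> (\<Sum>a\<in>div_support r - {0}. real_of_int \<bar>zorder f a\<bar> * ln (R / norm a))"
  proof (intro sum_mono mult_left_mono)
    fix a assume "a \<in> div_support r - {0}"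
    hence "2 * norm a \<le> R" "norm a > 0" using r by (auto simp: div_support_def)
    thus "ln 2 \<le> ln (R / norm a)" using R by (subst ln_le_cancel_iff) (auto simp: field_simps)
  qed auto
  also have "\<dots> \<le> (\<Sum>a\<in>div_support R - {0}. real_of_int \<bar>zorder f a\<bar> * ln (R / norm a))"
    using fin by (intro sum_mono2 sub) (auto simp: div_support_def)
  also have "\<dots> \<le> 2 * characteristic R f - leading_log"
    by (rule disc_estimates[OF R good])
  finally have "(\<Sum>a\<in>div_support r - {0}. real_of_int \<bar>zorder f a\<bar>) \<le> (2 * characteristic R f - leading_log) / ln 2"
    by (simp add: field_simps)
  moreover have "(\<Sum>a\<in>div_support r. real_of_int \<bar>zorder f a\<bar>) \<le> real_of_int \<bar>zorder f 0\<bar> + (\<Sum>a\<in>div_support r - {0}. real_of_int \<bar>zorder f a\<bar>)"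
    using fin(2) by (cases "0 \<in> div_support r") (simp_all add: sum.remove)
  ultimately show ?thesis by linarith
qed

text \<open>The factorization splits the difference into Re G, controlled through its derivative,
  and one term for each zero or pole. The latter keeps the distances to a, which are averaged over
  the circle only later.\<close>

lemma ln_quotient_estimate:
  fixes \<alpha> :: real
  assumes R: "R \<ge> 1" and good: "\<And>x. norm x = R \<Longrightarrow> x \<notin> exceptional"
    and x: "norm x \<le> 3 * R / 4" "x \<notin> exceptional" and w: "norm w \<le> 3 * R / 4" "w \<notin> exceptional"
    and \<alpha>: "0 < \<alpha>" "\<alpha> \<le> 1" and d: "norm (w - x) \<le> d"
  shows "\<bar>ln (norm (f w)) - ln (norm (f x))\<bar> \<le> 32 * d / R * (2 * characteristic R f - leading_log) +
     (\<Sum>a\<in>div_support R. real_of_int \<bar>zorder f a\<bar> *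
        (4 * d / R + 2 / \<alpha> * d powr \<alpha> * (norm (w - a) powr - \<alpha> + norm (x - a) powr - \<alpha>)))"
proof -
  obtain R' G where G: "R' > R" "G holomorphic_on ball 0 R'"
    "\<And>x. norm x \<le> R \<Longrightarrow> x \<notin> exceptional \<Longrightarrow> f x = exp (G x) * (\<Prod>a\<in>div_support R. blaschke R a x powi zorder f a)"
    "1 / (2 * pi) * integral {0..2*pi} (\<lambda>t. \<bar>Re (G (of_real R * exp (\<i> * of_real t)))\<bar>) \<le> 2 * characteristic R f - leading_log"
    using disc_estimates[OF R good] by blast
  define I where "I = 1 / (2 * pi) * integral {0..2*pi} (\<lambda>t. \<bar>Re (G (of_real R * exp (\<i> * of_real t)))\<bar>)"
  define S where "S = div_support R"
  have R0: "R > 0" using R by simp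
  \<comment> \<open>Read off from the derivative bound at 0, whose left-hand side is
    nonnegative.\<close>
  have I: "I \<ge> 0"
  proof -
    have "0 \<le> norm (deriv G 0)" by simp
    also have "\<dots> \<le> 2 * R / (R - norm (0::complex))\<^sup>2 * I"
      unfolding I_def by (rule deriv_bound_Re_boundary[OF G(2)]) (use R0 G(1) in auto)
    finally show ?thesis using R0 by (simp add: zero_le_mult_iff zero_le_divide_iff power2_eq_square)
  qed
  \<comment> \<open>The disc of radius 3R/4 is convex and stays R/4 away from the circle: 2 R /
    (R/4)^2 = 32 / R.\<close>
  have "norm (G w - G x) \<le> 32 / R * I * norm (w - x)"
  proof (rule field_differentiable_bound[of "cball 0 (3 * R / 4)"])
    fix z :: complex assume z: "z \<in> cball 0 (3 * R / 4)"
    have zb: "z \<in> ball 0 R'" using z G(1) R0 by auto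
    show "(G has_field_derivative deriv G z) (at z within cball 0 (3 * R / 4))"
      using holomorphic_derivI[OF G(2) _ zb] by (auto intro: DERIV_subset)
    have "norm (deriv G z) \<le> 2 * R / (R - norm z)\<^sup>2 * I"
      unfolding I_def by (rule deriv_bound_Re_boundary[OF G(2)]) (use R0 G(1) z in auto)
    also have "\<dots> \<le> 2 * R / (R / 4)\<^sup>2 * I"
      using z R0 I by (intro mult_right_mono divide_left_mono power_mono mult_pos_pos) auto
    also have "2 * R / (R / 4)\<^sup>2 = 32 / R" using R0 by (simp add: power2_eq_square field_simps)
    finally show "norm (deriv G z) \<le> 32 / R * I" .
  qed (use x w in auto)
  also have "\<dots> \<le> 32 / R * (2 * characteristic R f - leading_log) * d"
    using G(4) d R0 I by (intro mult_mono) (auto simp: I_def)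
  finally have 1: "\<bar>Re (G w) - Re (G x)\<bar> \<le> 32 * d / R * (2 * characteristic R f - leading_log)"
    using abs_Re_le_cmod[of "G w - G x"] by (simp add: mult_ac)
  have ln_eq: "ln (norm (f y)) = Re (G y) + (\<Sum>a\<in>S. of_int (zorder f a) * ln (norm (blaschke R a y)))"
    if y: "norm y \<le> 3 * R / 4" "y \<notin> exceptional" for y
  proof -
    have nz: "norm (blaschke R a y) > 0" if "a \<in> S" for a
    proof -
      have "y \<noteq> a" using that y zorder_nz_imp_exceptional by (auto simp: S_def div_support_def)
      thus ?thesis using blaschke_eq_0_iff[of a R y] that y R0 by (auto simp: S_def div_support_def)
    qed
    have "norm (f y) = exp (Re (G y)) * (\<Prod>a\<in>S. norm (blaschke R a y) powi zorder f a)"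
      using G(3)[of y] y R0 by (simp add: norm_mult norm_power_int S_def flip: prod_norm)
    moreover have "(\<Prod>a\<in>S. norm (blaschke R a y) powi zorder f a) > 0"
      by (intro prod_pos) (use nz in auto)
    ultimately have "ln (norm (f y)) = Re (G y) + ln (\<Prod>a\<in>S. norm (blaschke R a y) powi zorder f a)"
      by (simp add: ln_mult)
    also have "ln (\<Prod>a\<in>S. norm (blaschke R a y) powi zorder f a) = (\<Sum>a\<in>S. ln (norm (blaschke R a y) powi zorder f a))"
      using nz finite_div_support by (intro ln_prod) (auto simp: S_def)
    also have "\<dots> = (\<Sum>a\<in>S. of_int (zorder f a) * ln (norm (blaschke R a y)))"
      using nz by (intro sum.cong ln_powi) auto
    finally show ?thesis .
  qed
  have "\<bar>(\<Sum>a\<in>S. of_int (zorder f a) * ln (norm (blaschke R a w))) - (\<Sum>a\<in>S. of_int (zorder f a) * ln (norm (blaschke R a x)))\<bar>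
     \<le> (\<Sum>a\<in>S. real_of_int \<bar>zorder f a\<bar> *
        (4 * d / R + 2 / \<alpha> * d powr \<alpha> * (norm (w - a) powr - \<alpha> + norm (x - a) powr - \<alpha>)))"
    unfolding sum_subtractf[symmetric]
  proof (rule sum_norm_le[where 'a = real, unfolded real_norm_def])
    fix a assume a: "a \<in> S"
    have "w \<noteq> a" "x \<noteq> a" using a x w zorder_nz_imp_exceptional by (auto simp: S_def div_support_def)
    hence "\<bar>ln (norm (blaschke R a w)) - ln (norm (blaschke R a x))\<bar> \<le>
     4 * d / R + 2 / \<alpha> * d powr \<alpha> * (norm (w - a) powr - \<alpha> + norm (x - a) powr - \<alpha>)"
      using a by (intro ln_blaschke_diff R0 x w \<alpha> d) (auto simp: S_def div_support_def)
    thus "\<bar>of_int (zorder f a) * ln (norm (blaschke R a w)) - of_int (zorder f a) * ln (norm (blaschke R a x))\<bar>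
      \<le> real_of_int \<bar>zorder f a\<bar> * (4 * d / R + 2 / \<alpha> * d powr \<alpha> * (norm (w - a) powr - \<alpha> + norm (x - a) powr - \<alpha>))"
      unfolding right_diff_distrib[symmetric] abs_mult by (simp add: mult_left_mono)
  qed
  thus ?thesis
    using 1 unfolding ln_eq[OF x] ln_eq[OF w] S_def by linarith
qed

end

section \<open>Logarithmic quotients on large circles\<close>

lemma order_nonneg:
  assumes "nevanlinna_order f = ereal \<sigma>"
  shows "0 \<le> \<sigma>"
proof -
  have "\<forall>\<^sub>F r::real in at_top. 0 \<le> ereal (ln_plus (characteristic r f) / ln r)"
    using eventually_gt_at_top[of 1] by eventually_elim (simp add: ln_plus_nonneg)
  hence "0 \<le> nevanlinna_order f"
    unfolding nevanlinna_order_def by (intro le_Limsup) auto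
  thus ?thesis using assms by simp
qed

lemma characteristic_le_powr:
  assumes "nevanlinna_order f = ereal \<sigma>" "\<epsilon> > 0"
  shows "\<forall>\<^sub>F r in at_top. characteristic r f \<le> r powr (\<sigma> + \<epsilon>)"
proof -
  have "Limsup at_top (\<lambda>r. ereal (ln_plus (characteristic r f) / ln r)) < ereal (\<sigma> + \<epsilon>)"
    using assms by (simp add: nevanlinna_order_def)
  hence "\<forall>\<^sub>F r in at_top. ereal (ln_plus (characteristic r f) / ln r) < ereal (\<sigma> + \<epsilon>)"
    by (rule Limsup_lessD)
  thus ?thesis using eventually_gt_at_top[of 1]
  proof eventually_elim
    case (elim r)
    hence "ln_plus (characteristic r f) < (\<sigma> + \<epsilon>) * ln r" by (simp add: field_simps)
    hence "max 1 (characteristic r f) < exp ((\<sigma> + \<epsilon>) * ln r)"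
      unfolding ln_plus_def by (metis exp_less_mono exp_ln less_max_iff_disj zero_less_one)
    thus ?case using elim by (simp add: powr_def)
  qed
qed

section \<open>Exceptional angles and radii\<close>

lemma finite_shifted_square_angles:
  assumes fin: "\<And>R. finite (B \<inter> cball 0 R)" and \<rho>: "\<rho> > 0"
  shows "finite {\<theta> \<in> {0..2*pi}. (of_real \<rho> * cis (\<theta> / 2) + c)\<^sup>2 \<in> B}"
proof -
  define A where "A = {\<theta> \<in> {0..2*pi}. (of_real \<rho> * cis (\<theta> / 2) + c)\<^sup>2 \<in> B}"
  define B' where "B' = B \<inter> cball 0 ((\<rho> + norm c)\<^sup>2)"
  have "inj_on (\<lambda>\<theta>. of_real \<rho> * cis (\<theta> / 2)) A"
  proof (rule inj_onI)
    fix s t assume st: "s \<in> A" "t \<in> A" "of_real \<rho> * cis (s / 2) = of_real \<rho> * cis (t / 2)"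
    have "Re (of_real \<rho> * cis (s / 2)) = Re (of_real \<rho> * cis (t / 2))" by (simp only: st(3))
    hence "cos (s / 2) = cos (t / 2)" using \<rho> by simp
    from cos_inj_pi[OF _ _ _ _ this] show "s = t" using st(1,2) by (auto simp: A_def)
  qed
  moreover have "(\<lambda>\<theta>. of_real \<rho> * cis (\<theta> / 2)) ` A \<subseteq> (\<Union>b\<in>B'. {csqrt b - c, - csqrt b - c})"
  proof safe
    fix \<theta> assume \<theta>: "\<theta> \<in> A"
    define z where "z = of_real \<rho> * cis (\<theta> / 2)"
    have "norm (z + c) \<le> \<rho> + norm c"
      using norm_triangle_ineq[of z c] \<rho> by (simp add: z_def norm_mult)
    hence "norm ((z + c)\<^sup>2) \<le> (\<rho> + norm c)\<^sup>2" by (simp add: norm_power power_mono)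
    hence b: "(z + c)\<^sup>2 \<in> B'" using \<theta> by (simp add: A_def B'_def z_def)
    have "csqrt ((z + c)\<^sup>2) ^ 2 = (z + c)\<^sup>2" by simp
    hence "csqrt ((z + c)\<^sup>2) = z + c \<or> csqrt ((z + c)\<^sup>2) = - (z + c)" by (simp only: power2_eq_iff)
    hence "z \<in> {csqrt ((z + c)\<^sup>2) - c, - csqrt ((z + c)\<^sup>2) - c}" by auto
    thus "z \<in> (\<Union>b\<in>B'. {csqrt b - c, - csqrt b - c})" using b by blast
  qed
  moreover have "finite (\<Union>b\<in>B'. {csqrt b - c, - csqrt b - c})"
    unfolding B'_def by (rule finite_UN_I[OF fin]) simp
  ultimately have "finite A" using finite_imageD[OF finite_subset] by blast
  thus ?thesis by (simp add: A_def)
qed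

context nonzero_meromorphic
begin

text \<open>The exceptional set is countable, hence so is the set of its moduli, while an interval
  is not.\<close>

lemma good_radius:
  assumes "a < b"
  obtains R where "a < R" "R < b" "\<And>x. norm x = R \<Longrightarrow> x \<notin> exceptional"
proof -
  have "countable exceptional" using sparse_imp_countable[OF _ sparse_exceptional] by auto
  hence "countable (norm ` exceptional)" by (rule countable_image)
  hence "\<not> {a<..<b} \<subseteq> norm ` exceptional"
    using uncountable_open_interval[of a b] assms countable_subset by blast
  thus ?thesis using that by force
qed

text \<open>The analogue of the lemma on the logarithmic derivative: points at distance \<open>O(\<surd>r)\<close> on the
  circle of radius \<open>r\<close> gain a factor \<open>r\<^bsup>-1/2\<^esup>\<close> over the characteristic. Only a power
  \<open>\<alpha> < 1\<close> of the distances to zeros and poles is integrable, whence the loss of \<open>\<epsilon>\<close>.\<close>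

lemma ln_shift_quotient_majorant:
  fixes s \<sigma> \<epsilon> :: real
  assumes order: "nevanlinna_order f = ereal \<sigma>" and \<epsilon>: "\<epsilon> > 0"
  obtains C where "C \<ge> 0"
    "\<forall>\<^sub>F r in at_top. \<exists>h N. h integrable_on {0..2*pi} \<and> (\<forall>\<theta>. 0 \<le> h \<theta>) \<and> finite N \<and>
       integral {0..2*pi} h \<le> C * r powr (\<sigma> - 1 / 2 + \<epsilon>) \<and>
       (\<forall>\<theta>\<in>{0..2*pi} - N. \<bar>ln (norm (f ((of_real (sqrt r) * cis (\<theta> / 2) + \<i> * of_real s / 2)\<^sup>2)))
           - ln (norm (f ((of_real (sqrt r) * cis (\<theta> / 2))\<^sup>2)))\<bar> \<le> h \<theta>)"
proof -
  \<comment> \<open>Half of \<epsilon> pays for the growth of the characteristic and at most half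
    for \<alpha> < 1: the exponent p - \<alpha>/2 equals \<sigma> + \<epsilon>/2 - 1/2 + \<delta>/2.
    The cap 1/2 keeps \<alpha> positive.\<close>
  define \<delta> where "\<delta> = min \<epsilon> (1 / 2)"
  define \<alpha> where "\<alpha> = 1 - \<delta>"
  define p where "p = \<sigma> + \<epsilon> / 2"
  have \<delta>: "0 < \<delta>" "\<delta> \<le> 1 / 2" "\<delta> \<le> \<epsilon>" using \<epsilon> by (auto simp: \<delta>_def)
  have \<alpha>: "0 < \<alpha>" "\<alpha> < 1" using \<delta> by (auto simp: \<alpha>_def)
  have p: "0 \<le> p" using order_nonneg[OF order] \<epsilon> by (simp add: p_def)
  obtain C1 where C1: "C1 > 0"
    "\<And>\<rho> s a. \<lbrakk>\<rho> > 0; \<bar>s\<bar> \<le> \<rho>\<rbrakk> \<Longrightarrow> \<exists>h. h integrable_on {0..2*pi} \<and> (\<forall>\<theta>. 0 \<le> h \<theta>) \<and>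
       integral {0..2*pi} h \<le> C1 * (\<rho>\<^sup>2) powr - \<alpha> \<and>
       (\<forall>\<theta>\<in>{0..2*pi}. norm ((of_real \<rho> * cis (\<theta> / 2) + \<i> * of_real s / 2)\<^sup>2 - a) powr - \<alpha> \<le> h \<theta>)"
    using shifted_square_dist_powr_majorant[OF \<alpha>] by blast
  define K where "K = \<bar>leading_log\<bar> + \<bar>real_of_int (zorder f 0)\<bar>"
  define A1 where "A1 = 2 * 3 powr p + K"
  define A2 where "A2 = K + (2 * 7 powr p + K) / ln 2"
  have K: "K \<ge> 0" by (simp add: K_def)
  have A: "A1 \<ge> 0" "A2 \<ge> 0" using K by (auto simp: A1_def A2_def)
  define D where "D = 2 * \<bar>s\<bar>"
  define C where "C = 2 * pi * 16 * D * A1 + A2 * (2 * pi * 2 * D) + A2 * (4 / \<alpha> * D powr \<alpha> * C1)"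
  have C0: "C \<ge> 0" using A C1 \<alpha> by (auto simp: C_def D_def)
  obtain r0 where r0: "\<And>r. r \<ge> r0 \<Longrightarrow> characteristic r f \<le> r powr p"
    using characteristic_le_powr[OF order, of "\<epsilon> / 2"] \<epsilon> by (auto simp: eventually_at_top_linorder p_def)
  have main: "\<exists>h N. h integrable_on {0..2*pi} \<and> (\<forall>\<theta>. 0 \<le> h \<theta>) \<and> finite N \<and>
       integral {0..2*pi} h \<le> C * r powr (\<sigma> - 1 / 2 + \<epsilon>) \<and>
       (\<forall>\<theta>\<in>{0..2*pi} - N. \<bar>ln (norm (f ((of_real (sqrt r) * cis (\<theta> / 2) + \<i> * of_real s / 2)\<^sup>2)))
           - ln (norm (f ((of_real (sqrt r) * cis (\<theta> / 2))\<^sup>2)))\<bar> \<le> h \<theta>)"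
    if r: "r \<ge> max (max 1 r0) ((4 * \<bar>s\<bar>)\<^sup>2)" for r
  proof -
    define \<rho> where "\<rho> = sqrt r"
    have r1: "r \<ge> 1" "r \<ge> r0" using r by auto
    have \<rho>: "\<rho> \<ge> 1" "\<rho>\<^sup>2 = r" "4 * \<bar>s\<bar> \<le> \<rho>"
      using r r1 by (auto simp: \<rho>_def real_le_rsqrt)
    have \<rho>0: "\<rho> > 0" using \<rho> by simp
    \<comment> \<open>R > 2r leaves room for the shifted points in the disc of radius 3R/4, and the
      second radius exceeds 6r > 2R, so that it controls the zeros and poles of modulus below R. The
      upper ends 3r and 7r explain the 3 and 7 in \<open>A1\<close> and \<open>A2\<close>.\<close>
    obtain R where R: "2 * r < R" "R < 3 * r" "\<And>x. norm x = R \<Longrightarrow> x \<notin> exceptional"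
      using good_radius[of "2 * r" "3 * r"] r1 by auto
    obtain R2 where R2: "6 * r < R2" "R2 < 7 * r" "\<And>x. norm x = R2 \<Longrightarrow> x \<notin> exceptional"
      using good_radius[of "6 * r" "7 * r"] r1 by auto
    define M where "M = 2 * characteristic R f - leading_log"
    define S where "S = div_support R"
    have S: "finite S" by (simp add: S_def finite_div_support)
    have rp: "1 \<le> r powr p" using r1(1) p by (rule ge_one_powr_ge_zero)
    have powr_le: "2 * characteristic t f - leading_log \<le> (2 * c powr p + K) * r powr p"
      if "r \<le> t" "t < c * r" "0 < c" for c t
    proof -
      have "characteristic t f \<le> t powr p" using r0 that r1 by simp
      also have "\<dots> \<le> (c * r) powr p" using that r1 p by (intro powr_mono2) auto
      also have "\<dots> = c powr p * r powr p" by (rule powr_mult)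
      finally have "characteristic t f \<le> c powr p * r powr p" .
      moreover have "- leading_log \<le> K * r powr p"
        using mult_mono[OF order_refl rp, of K] K by (auto simp: K_def)
      ultimately show ?thesis by (simp add: algebra_simps)
    qed
    have M: "M \<le> A1 * r powr p" unfolding M_def A1_def using R r1 by (intro powr_le) auto
    have M0: "0 \<le> M"
    proof -
      have R1: "R \<ge> 1" using R r1 by simp
      have "0 \<le> (\<Sum>a\<in>div_support R - {0}. real_of_int \<bar>zorder f a\<bar> * ln (R / norm a))"
        by (intro sum_nonneg mult_nonneg_nonneg ln_ge_zero) (auto simp: div_support_def)
      also have "\<dots> \<le> M" unfolding M_def by (rule disc_estimates[OF R1 R(3)])
      finally show ?thesis .
    qed
    define n where "n = (\<Sum>a\<in>S. real_of_int \<bar>zorder f a\<bar>)"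
    have n0: "0 \<le> n" by (simp add: n_def sum_nonneg)
    have n: "n \<le> A2 * r powr p"
    proof -
      have "n \<le> real_of_int \<bar>zorder f 0\<bar> + (2 * characteristic R2 f - leading_log) / ln 2"
        unfolding n_def S_def using R R2 r1 by (intro sum_abs_zorder_le) auto
      also have "\<dots> \<le> K * r powr p + ((2 * 7 powr p + K) * r powr p) / ln 2"
      proof (intro add_mono divide_right_mono powr_le)
        have "real_of_int \<bar>zorder f 0\<bar> \<le> K * 1" by (simp add: K_def)
        also have "\<dots> \<le> K * r powr p" using rp K by (intro mult_left_mono)
        finally show "real_of_int \<bar>zorder f 0\<bar> \<le> K * r powr p" .
      qed (use R2 r1 in auto)
      also have "\<dots> = A2 * r powr p" by (simp add: A2_def field_simps)
      finally show ?thesis .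
    qed
    \<comment> \<open>Shifting z by \<i> s / 2 moves z^2 by \<i> s (z + \<i> s / 4), which is of
      order \<rho> = sqrt r only. This is the source of the gain r^(-1/2).\<close>
    define d where "d = D * \<rho>"
    have d0: "d \<ge> 0" using \<rho>0 by (simp add: d_def D_def)
    have "\<exists>h. \<forall>a. h a integrable_on {0..2*pi} \<and> (\<forall>\<theta>. 0 \<le> h a \<theta>) \<and>
       integral {0..2*pi} (h a) \<le> C1 * r powr - \<alpha> \<and>
       (\<forall>\<theta>\<in>{0..2*pi}. norm ((of_real \<rho> * cis (\<theta> / 2) + \<i> * of_real t / 2)\<^sup>2 - a) powr - \<alpha> \<le> h a \<theta>)"
      if "\<bar>t\<bar> \<le> \<rho>" for t
      using C1(2)[OF \<rho>0 that] unfolding \<rho>(2) by (intro choice allI)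
    note ex = this
    have s\<rho>: "\<bar>0::real\<bar> \<le> \<rho>" "\<bar>s\<bar> \<le> \<rho>" using \<rho> by auto
    obtain h0 where H0: "\<forall>a. h0 a integrable_on {0..2*pi} \<and> (\<forall>\<theta>. 0 \<le> h0 a \<theta>) \<and>
       integral {0..2*pi} (h0 a) \<le> C1 * r powr - \<alpha> \<and>
       (\<forall>\<theta>\<in>{0..2*pi}. norm ((of_real \<rho> * cis (\<theta> / 2) + \<i> * of_real 0 / 2)\<^sup>2 - a) powr - \<alpha> \<le> h0 a \<theta>)"
      using ex[OF s\<rho>(1)] by blast
    have h0: "h0 a integrable_on {0..2*pi}" "0 \<le> h0 a \<theta>" "integral {0..2*pi} (h0 a) \<le> C1 * r powr - \<alpha>"
       "\<theta>\<in>{0..2*pi} \<Longrightarrow> norm ((of_real \<rho> * cis (\<theta> / 2))\<^sup>2 - a) powr - \<alpha> \<le> h0 a \<theta>" for a \<theta>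
      using H0[rule_format, of a] by auto
    obtain h1 where H1: "\<forall>a. h1 a integrable_on {0..2*pi} \<and> (\<forall>\<theta>. 0 \<le> h1 a \<theta>) \<and>
       integral {0..2*pi} (h1 a) \<le> C1 * r powr - \<alpha> \<and>
       (\<forall>\<theta>\<in>{0..2*pi}. norm ((of_real \<rho> * cis (\<theta> / 2) + \<i> * of_real s / 2)\<^sup>2 - a) powr - \<alpha> \<le> h1 a \<theta>)"
      using ex[OF s\<rho>(2)] by blast
    have h1: "h1 a integrable_on {0..2*pi}" "0 \<le> h1 a \<theta>" "integral {0..2*pi} (h1 a) \<le> C1 * r powr - \<alpha>"
       "\<theta>\<in>{0..2*pi} \<Longrightarrow> norm ((of_real \<rho> * cis (\<theta> / 2) + \<i> * of_real s / 2)\<^sup>2 - a) powr - \<alpha> \<le> h1 a \<theta>" for a \<theta>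
      using H1[rule_format, of a] by auto
    define h where "h \<theta> = 32 * d / R * M + (\<Sum>a\<in>S. real_of_int \<bar>zorder f a\<bar> *
        (4 * d / R + 2 / \<alpha> * d powr \<alpha> * (h1 a \<theta> + h0 a \<theta>)))" for \<theta>
    define N where "N = {\<theta> \<in> {0..2*pi}. (of_real \<rho> * cis (\<theta> / 2) + \<i> * of_real s / 2)\<^sup>2 \<in> exceptional} \<union>
       {\<theta> \<in> {0..2*pi}. (of_real \<rho> * cis (\<theta> / 2) + 0)\<^sup>2 \<in> exceptional}"
    have R0: "R > 0" using R r1 by simp
    have "h integrable_on {0..2*pi}"
      unfolding h_def by (intro integrable_add integrable_const_ivl integrable_sum integrable_on_mult_right h0 h1 S)
    moreover have "\<forall>\<theta>. 0 \<le> h \<theta>"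
      unfolding h_def using d0 R0 M0 \<alpha> h0(2) h1(2) by (auto intro!: add_nonneg_nonneg sum_nonneg mult_nonneg_nonneg)
    moreover have "finite N"
      unfolding N_def by (intro finite_UnI finite_shifted_square_angles finite_exceptional \<rho>0)
    moreover have "integral {0..2*pi} h \<le> C * r powr (\<sigma> - 1 / 2 + \<epsilon>)"
    proof -
      define q where "q = \<sigma> - 1 / 2 + \<epsilon>"
      have \<rho>p: "\<rho> = r powr (1 / 2)" using r1 by (simp add: \<rho>_def powr_half_sqrt)
      have dR: "d / R \<le> D / 2 * r powr (- 1 / 2)"
      proof -
        have "d / R \<le> d / (2 * r)" using d0 R r1 by (intro divide_left_mono) auto
        also have "\<dots> = D / 2 * (\<rho> / \<rho>\<^sup>2)" by (simp add: d_def \<rho>)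
        also have "\<rho> / \<rho>\<^sup>2 = 1 / \<rho>" using \<rho>0 by (simp add: power2_eq_square)
        also have "1 / \<rho> = r powr (- 1 / 2)" unfolding \<rho>p using powr_minus_divide[of r "1 / 2"] by simp
        finally show ?thesis .
      qed
      have dR0: "0 \<le> d / R" using d0 R0 by simp
      have q1: "r powr p * r powr (- 1 / 2) \<le> r powr q"
        unfolding powr_add[symmetric] using r1 \<epsilon> by (intro powr_mono) (auto simp: p_def q_def)
      have q2: "r powr p * (r powr (\<alpha> / 2) * r powr - \<alpha>) \<le> r powr q"
        unfolding powr_add[symmetric] using r1 \<delta> by (intro powr_mono) (auto simp: p_def q_def \<alpha>_def field_simps)
      have d\<alpha>: "d powr \<alpha> = D powr \<alpha> * r powr (\<alpha> / 2)"
        unfolding d_def powr_mult \<rho>p powr_powr by simp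
      have hc: "((\<lambda>_. c) has_integral 2 * pi * c) {0..2*pi}" for c :: real
        using has_integral_const_real[of c 0 "2 * pi"] by simp
      have "(h has_integral 2 * pi * (32 * d / R * M) + (\<Sum>a\<in>S. real_of_int \<bar>zorder f a\<bar> *
          (2 * pi * (4 * d / R) + 2 / \<alpha> * d powr \<alpha> * (integral {0..2*pi} (h1 a) + integral {0..2*pi} (h0 a))))) {0..2*pi}"
        unfolding h_def
        by (rule has_integral_add[OF hc has_integral_sum[OF S has_integral_mult_right[OF has_integral_add[OF hc
              has_integral_mult_right[OF has_integral_add[OF integrable_integral[OF h1(1)] integrable_integral[OF h0(1)]]]]]]])
      hence "integral {0..2*pi} h = 2 * pi * (32 * d / R * M) + (\<Sum>a\<in>S. real_of_int \<bar>zorder f a\<bar> *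
          (2 * pi * (4 * d / R) + 2 / \<alpha> * d powr \<alpha> * (integral {0..2*pi} (h1 a) + integral {0..2*pi} (h0 a))))"
        by (rule integral_unique)
      also have "\<dots> \<le> 2 * pi * (32 * d / R * M) + (\<Sum>a\<in>S. real_of_int \<bar>zorder f a\<bar> *
          (2 * pi * (4 * d / R) + 2 / \<alpha> * d powr \<alpha> * (C1 * r powr - \<alpha> + C1 * r powr - \<alpha>)))"
        using \<alpha> by (intro add_mono sum_mono mult_left_mono order_refl h0 h1) auto
      also have "\<dots> = 2 * pi * (32 * d / R * M) + n *
          (2 * pi * (4 * d / R) + 2 / \<alpha> * d powr \<alpha> * (C1 * r powr - \<alpha> + C1 * r powr - \<alpha>))"
        by (simp only: n_def sum_distrib_right)
      also have "\<dots> = 64 * pi * (M * (d / R)) + 8 * pi * (n * (d / R)) + 4 / \<alpha> * C1 * D powr \<alpha> * (n * (r powr (\<alpha> / 2) * r powr - \<alpha>))"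
        unfolding d\<alpha> by (simp add: algebra_simps)
      also have "\<dots> \<le> 64 * pi * (A1 * r powr p * (D / 2 * r powr (- 1 / 2))) + 8 * pi * (A2 * r powr p * (D / 2 * r powr (- 1 / 2)))
            + 4 / \<alpha> * C1 * D powr \<alpha> * (A2 * r powr p * (r powr (\<alpha> / 2) * r powr - \<alpha>))"
      proof -
        have m1: "M * (d / R) \<le> A1 * r powr p * (D / 2 * r powr (- 1 / 2))"
          by (rule mult_mono[OF M dR _ dR0]) (use A in simp)
        have m2: "n * (d / R) \<le> A2 * r powr p * (D / 2 * r powr (- 1 / 2))"
          by (rule mult_mono[OF n dR _ dR0]) (use A in simp)
        have m3: "n * (r powr (\<alpha> / 2) * r powr - \<alpha>) \<le> A2 * r powr p * (r powr (\<alpha> / 2) * r powr - \<alpha>)"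
          by (rule mult_right_mono[OF n]) simp
        have c3: "0 \<le> 4 / \<alpha> * C1 * D powr \<alpha>" using \<alpha> C1 by simp
        show ?thesis
          using mult_left_mono[OF m1, of "64 * pi"] mult_left_mono[OF m2, of "8 * pi"] mult_left_mono[OF m3 c3]
            pi_ge_zero by linarith
      qed
      also have "\<dots> = (2 * pi * 16 * D * A1 + A2 * (2 * pi * 2 * D)) * (r powr p * r powr (- 1 / 2))
            + A2 * (4 / \<alpha> * D powr \<alpha> * C1) * (r powr p * (r powr (\<alpha> / 2) * r powr - \<alpha>))"
        by (simp add: algebra_simps)
      also have "\<dots> \<le> (2 * pi * 16 * D * A1 + A2 * (2 * pi * 2 * D)) * r powr q
            + A2 * (4 / \<alpha> * D powr \<alpha> * C1) * r powr q"
        using A C1 \<alpha> by (intro add_mono mult_left_mono q1 q2) (auto simp: D_def)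
      also have "\<dots> = C * r powr q" by (simp add: C_def algebra_simps)
      finally show ?thesis by (simp add: q_def)
    qed
    moreover have "\<bar>ln (norm (f ((of_real \<rho> * cis (\<theta> / 2) + \<i> * of_real s / 2)\<^sup>2)))
           - ln (norm (f ((of_real \<rho> * cis (\<theta> / 2))\<^sup>2)))\<bar> \<le> h \<theta>" if \<theta>: "\<theta> \<in> {0..2*pi} - N" for \<theta>
    proof -
      define z where "z = of_real \<rho> * cis (\<theta> / 2)"
      define x w where "x = z\<^sup>2" and "w = (z + \<i> * of_real s / 2)\<^sup>2"
      have nz: "norm z = \<rho>" using \<rho>0 by (simp add: z_def norm_mult)
      have xb: "x \<notin> exceptional" "w \<notin> exceptional" using \<theta> by (auto simp: N_def x_def w_def z_def)
      have nx: "norm x = r" by (simp add: x_def norm_power nz \<rho>)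
      have "w - x = \<i> * of_real s * (z + \<i> * of_real s / 4)"
        by (simp add: w_def x_def power2_eq_square field_simps)
      hence "norm (w - x) = \<bar>s\<bar> * norm (z + \<i> * of_real s / 4)" by (simp only: norm_mult) simp
      also have "\<dots> \<le> \<bar>s\<bar> * (\<rho> + \<bar>s\<bar> / 4)"
        using norm_triangle_ineq[of z "\<i> * of_real s / 4"] by (intro mult_left_mono) (auto simp: nz norm_mult norm_divide)
      also have "\<dots> \<le> \<bar>s\<bar> * (2 * \<rho>)" using \<rho> by (intro mult_left_mono) auto
      finally have wx: "norm (w - x) \<le> d" by (simp add: d_def D_def)
      \<comment> \<open>Then \<bar>w\<bar> is at most 3r/2, which is below 3R/4.\<close>
      have "d \<le> r / 2"
        using mult_right_mono[OF \<rho>(3), of \<rho>] \<rho>0 \<rho>(2) unfolding d_def D_def power2_eq_square by linarith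
      hence nw: "norm w \<le> 3 * R / 4"
        using norm_triangle_ineq[of x "w - x"] wx nx R(1) r1 by simp
      have "\<bar>ln (norm (f w)) - ln (norm (f x))\<bar> \<le> 32 * d / R * (2 * characteristic R f - leading_log) +
         (\<Sum>a\<in>div_support R. real_of_int \<bar>zorder f a\<bar> *
            (4 * d / R + 2 / \<alpha> * d powr \<alpha> * (norm (w - a) powr - \<alpha> + norm (x - a) powr - \<alpha>)))"
      proof (rule ln_quotient_estimate[OF _ R(3) _ xb(1) nw xb(2) \<alpha>(1) _ wx])
        show "R \<ge> 1" "norm x \<le> 3 * R / 4" "\<alpha> \<le> 1" using R(1) r1 nx \<alpha> by auto
      qed
      also have "\<dots> \<le> h \<theta>"
        unfolding h_def M_def[symmetric] S_def[symmetric] using \<alpha> \<theta>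
        by (intro add_mono sum_mono mult_left_mono order_refl) (auto simp: w_def x_def z_def h0(4) h1(4))
      finally show ?thesis by (simp add: w_def x_def z_def)
    qed
    ultimately show ?thesis unfolding \<rho>_def by blast
  qed
  show ?thesis
    by (rule that[OF C0], rule eventually_mono[OF eventually_ge_at_top], rule main)
qed

end

section \<open>Clunie's argument\<close>

text \<open>If \<open>g\<close> has no integral, its \<open>integral\<close> is 0 and nonnegativity
  of \<open>H\<close> suffices. This spares a discussion of the integrability of ln_plus
  \<bar>P(f)\<bar> on circles that pass through poles.\<close>

lemma integral_le_off_finite:
  fixes g H :: "real \<Rightarrow> real"
  assumes H: "H integrable_on S" "\<And>x. 0 \<le> H x" and N: "finite N" and le: "\<And>x. x \<in> S - N \<Longrightarrow> g x \<le> H x"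
  shows "integral S g \<le> integral S H"
proof (cases "g integrable_on S")
  case True
  define H' where "H' x = (if x \<in> N then g x else H x)" for x
  have "H' integrable_on S"
    by (rule integrable_spike_finite[OF N _ H(1)]) (auto simp: H'_def)
  hence "integral S g \<le> integral S H'"
    by (intro integral_le True) (auto simp: H'_def le)
  also have "integral S H' = integral S H"
    by (rule integral_spike[OF negligible_finite[OF N]]) (auto simp: H'_def)
  finally show ?thesis .
next
  case False
  thus ?thesis using integral_nonneg[OF H(1)] H(2) by (simp add: not_integrable_integral)
qed

lemma sum_list_le_wilson_poly_degree:
  assumes "(c, d) \<in> set P"
  shows "sum_list d \<le> wilson_poly_degree P"
  unfolding wilson_poly_degree_def by (rule Max_ge) (use assms in force)+

text \<open>On the part of the circle where \<open>\<bar>f\<bar> \<le> 1\<close> one estimates \<open>P(f)\<close> itself, elsewhere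
  \<open>Q(f) / f\<^sup>n\<close>.\<close>

lemma clunie_pointwise:
  fixes P Q :: wilson_poly
  assumes deg: "wilson_poly_degree Q \<le> n"
  obtains K \<kappa> D L where "K \<ge> 1"
    "\<And>f z U. \<lbrakk>real L + 1 \<le> norm z; 1 \<le> U; f (z\<^sup>2) \<noteq> 0;
       f (z\<^sup>2) ^ n * wilson_poly_eval P f (z\<^sup>2) = wilson_poly_eval Q f (z\<^sup>2);
       \<And>k::int. \<bar>k\<bar> \<le> int L \<Longrightarrow> norm (f ((z + \<i> * of_int k / 2)\<^sup>2)) \<le> U * norm (f (z\<^sup>2))\<rbrakk> \<Longrightarrow>
       norm (wilson_poly_eval P f (z\<^sup>2)) \<le> K * norm (z\<^sup>2) ^ \<kappa> * U ^ D"
proof -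
  define L where "L = Max (insert 0 ((\<lambda>(c, d). length d) ` set (P @ Q)))"
  have L: "length d \<le> L" if "(c, d) \<in> set (P @ Q)" for c d
    unfolding L_def by (rule Max_ge) (use that in force)+
  \<comment> \<open>The power of U is at most the degree of P where \<bar>f\<bar> \<le> 1, and n
    elsewhere.\<close>
  define D where "D = max (wilson_poly_degree P) n"
  have P: "sum_list d \<le> D \<and> length d \<le> L" if "(c, d) \<in> set P" for c d
    using sum_list_le_wilson_poly_degree[OF that] L[of c d] that by (simp add: D_def)
  have Q: "sum_list d \<le> n \<and> length d \<le> L" if "(c, d) \<in> set Q" for c d
    using sum_list_le_wilson_poly_degree[OF that] L[of c d] that deg by simp
  obtain K1 \<kappa>1 where 1: "K1 \<ge> 0" "\<And>f x y U. \<lbrakk>1 \<le> norm x; 1 \<le> U; 0 < y; \<And>l. l < L \<Longrightarrow> norm ((wilson ^^ l) f x) \<le> U * y\<rbrakk> \<Longrightarrow>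
       norm (wilson_poly_eval P f x) \<le> K1 * norm x ^ \<kappa>1 * (U ^ D * max 1 y ^ D)"
    by (rule wilson_poly_eval_bound[of P D L]) (use P in blast)+
  obtain K2 \<kappa>2 where 2: "K2 \<ge> 0" "\<And>f x y U. \<lbrakk>1 \<le> norm x; 1 \<le> U; 0 < y; \<And>l. l < L \<Longrightarrow> norm ((wilson ^^ l) f x) \<le> U * y\<rbrakk> \<Longrightarrow>
       norm (wilson_poly_eval Q f x) \<le> K2 * norm x ^ \<kappa>2 * (U ^ n * max 1 y ^ n)"
    by (rule wilson_poly_eval_bound[of Q n L]) (use Q in blast)+
  define K where "K = K1 + K2 + 1"
  define \<kappa> where "\<kappa> = \<kappa>1 + \<kappa>2"
  show ?thesis
  proof (rule that[of K L \<kappa> D])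
    show "K \<ge> 1" using 1(1) 2(1) by (simp add: K_def)
    fix f :: "complex \<Rightarrow> complex" and z :: complex and U :: real
    assume z: "real L + 1 \<le> norm z" and U: "1 \<le> U" and nz: "f (z\<^sup>2) \<noteq> 0"
      and eq: "f (z\<^sup>2) ^ n * wilson_poly_eval P f (z\<^sup>2) = wilson_poly_eval Q f (z\<^sup>2)"
      and le: "\<And>k::int. \<bar>k\<bar> \<le> int L \<Longrightarrow> norm (f ((z + \<i> * of_int k / 2)\<^sup>2)) \<le> U * norm (f (z\<^sup>2))"
    define x y where "x = z\<^sup>2" and "y = norm (f x)"
    have y: "0 < y" using nz by (simp add: y_def x_def)
    have x: "1 \<le> norm x" using z by (simp add: x_def norm_power one_le_power)
    have W: "norm ((wilson ^^ l) f x) \<le> U * y" if "l < L" for l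
      unfolding x_def
      by (rule norm_funpow_wilson_le) (use le that z in \<open>auto simp: x_def y_def\<close>)
    have "norm (wilson_poly_eval P f x) \<le> K * norm x ^ \<kappa> * U ^ D"
    proof (cases "y \<le> 1")
      case True
      have "norm (wilson_poly_eval P f x) \<le> K1 * norm x ^ \<kappa>1 * (U ^ D * max 1 y ^ D)"
        by (rule 1(2)) (use x U y W in auto)
      also have "max 1 y = 1" using True by simp
      also have "K1 * norm x ^ \<kappa>1 * (U ^ D * 1 ^ D) \<le> K * norm x ^ \<kappa> * U ^ D"
        unfolding power_one mult_1_right using x U 1(1) 2(1)
        by (intro mult_right_mono mult_mono power_increasing) (auto simp: K_def \<kappa>_def)
      finally show ?thesis .
    next
      case False
      have "y ^ n * norm (wilson_poly_eval P f x) = norm (wilson_poly_eval Q f x)"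
        using arg_cong[OF eq, of norm] by (simp add: norm_mult norm_power y_def x_def)
      also have "\<dots> \<le> K2 * norm x ^ \<kappa>2 * (U ^ n * max 1 y ^ n)"
        by (rule 2(2)) (use x U y W in auto)
      also have "max 1 y = y" using False by simp
      \<comment> \<open>Here the degree condition on Q acts: the power of y on the right is exactly
        n and cancels.\<close>
      finally have "y ^ n * norm (wilson_poly_eval P f x) \<le> y ^ n * (K2 * norm x ^ \<kappa>2 * U ^ n)"
        by (simp add: mult_ac)
      hence "norm (wilson_poly_eval P f x) \<le> K2 * norm x ^ \<kappa>2 * U ^ n"
        using y by simp
      also have "\<dots> \<le> K * norm x ^ \<kappa> * U ^ D"
        using x U 1(1) 2(1)
        by (intro mult_mono power_increasing) (auto simp: K_def \<kappa>_def D_def)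
      finally show ?thesis .
    qed
    thus "norm (wilson_poly_eval P f (z\<^sup>2)) \<le> K * norm (z\<^sup>2) ^ \<kappa> * U ^ D" by (simp add: x_def)
  qed
qed

text \<open>The pointwise bound is applied with U = exp (sum of the majorants over all shifts). Its
  logarithm is ln K + \<kappa> ln r plus D times that sum; the first part yields the term in ln r,
  and the integrals of the majorants yield the power of r.\<close>

lemma proximity_wilson_poly_le:
  fixes n :: nat and P Q :: wilson_poly and f :: "complex \<Rightarrow> complex" and \<sigma> \<epsilon> :: real
  assumes deg: "wilson_poly_degree Q \<le> n"
    and mero: "f meromorphic_on UNIV" and nzero: "\<not> (\<forall>\<^sub>\<approx>x. f x = 0)"
    and order: "nevanlinna_order f = ereal \<sigma>"
    and eq: "\<forall>\<^sub>\<approx>x. f x ^ n * wilson_poly_eval P f x = wilson_poly_eval Q f x"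
    and \<epsilon>: "\<epsilon> > 0"
  obtains C1 C2 where "C1 \<ge> 0" "C2 \<ge> 0"
    "\<forall>\<^sub>F r in at_top. proximity r (wilson_poly_eval P f) \<le> C1 * r powr (\<sigma> - 1 / 2 + \<epsilon>) + C2 * ln r"
proof -
  interpret nonzero_meromorphic f by standard (fact mero nzero)+
  define E where "E = {x. f x ^ n * wilson_poly_eval P f x \<noteq> wilson_poly_eval Q f x}"
  define q where "q = \<sigma> - 1 / 2 + \<epsilon>"
  have "E sparse_in UNIV" using eq by (simp add: eventually_cosparse E_def)
  hence finE: "finite (E \<inter> cball 0 R)" for R
    by (metis compact_cball inf_commute sparse_in_compact_finite sparse_in_subset top_greatest)
  obtain K \<kappa> D L where K: "K \<ge> 1"
    "\<And>f z U. \<lbrakk>real L + 1 \<le> norm z; 1 \<le> U; f (z\<^sup>2) \<noteq> 0;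
       f (z\<^sup>2) ^ n * wilson_poly_eval P f (z\<^sup>2) = wilson_poly_eval Q f (z\<^sup>2);
       \<And>k::int. \<bar>k\<bar> \<le> int L \<Longrightarrow> norm (f ((z + \<i> * of_int k / 2)\<^sup>2)) \<le> U * norm (f (z\<^sup>2))\<rbrakk> \<Longrightarrow>
       norm (wilson_poly_eval P f (z\<^sup>2)) \<le> K * norm (z\<^sup>2) ^ \<kappa> * U ^ D"
    using clunie_pointwise[OF deg, of P thesis] by blast
  define J where "J = {- int L..int L}"
  have "\<exists>C. \<forall>k::int. C k \<ge> 0 \<and>
    (\<forall>\<^sub>F r in at_top. \<exists>h N. h integrable_on {0..2*pi} \<and> (\<forall>\<theta>. 0 \<le> h \<theta>) \<and> finite N \<and>
       integral {0..2*pi} h \<le> C k * r powr q \<and>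
       (\<forall>\<theta>\<in>{0..2*pi} - N. \<bar>ln (norm (f ((of_real (sqrt r) * cis (\<theta> / 2) + \<i> * of_real (of_int k) / 2)\<^sup>2)))
           - ln (norm (f ((of_real (sqrt r) * cis (\<theta> / 2))\<^sup>2)))\<bar> \<le> h \<theta>))"
    unfolding q_def by (intro choice allI) (rule ln_shift_quotient_majorant[OF order \<epsilon>], blast)
  then obtain C where C: "\<And>k. C k \<ge> 0" and
    "\<And>k. \<forall>\<^sub>F r in at_top. \<exists>h N. h integrable_on {0..2*pi} \<and> (\<forall>\<theta>. 0 \<le> h \<theta>) \<and> finite N \<and>
       integral {0..2*pi} h \<le> C k * r powr q \<and>
       (\<forall>\<theta>\<in>{0..2*pi} - N. \<bar>ln (norm (f ((of_real (sqrt r) * cis (\<theta> / 2) + \<i> * of_real (of_int k) / 2)\<^sup>2)))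
           - ln (norm (f ((of_real (sqrt r) * cis (\<theta> / 2))\<^sup>2)))\<bar> \<le> h \<theta>)"
    by blast
  hence ev: "\<forall>\<^sub>F r in at_top. \<forall>k\<in>J. \<exists>h N. h integrable_on {0..2*pi} \<and> (\<forall>\<theta>. 0 \<le> h \<theta>) \<and> finite N \<and>
       integral {0..2*pi} h \<le> C k * r powr q \<and>
       (\<forall>\<theta>\<in>{0..2*pi} - N. \<bar>ln (norm (f ((of_real (sqrt r) * cis (\<theta> / 2) + \<i> * of_real (of_int k) / 2)\<^sup>2)))
           - ln (norm (f ((of_real (sqrt r) * cis (\<theta> / 2))\<^sup>2)))\<bar> \<le> h \<theta>)"
    by (intro eventually_ball_finite) (auto simp: J_def)
  define C1 where "C1 = real D / (2 * pi) * (\<Sum>k\<in>J. C k)"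
  define C2 where "C2 = ln K + real \<kappa>"
  have C1: "0 \<le> C1" using C by (auto simp: C1_def intro!: sum_nonneg divide_nonneg_pos mult_nonneg_nonneg)
  have C2: "0 \<le> C2" using K(1) by (simp add: C2_def)
  have "\<forall>\<^sub>F r in at_top. proximity r (wilson_poly_eval P f) \<le> C1 * r powr q + C2 * ln r"
    using ev eventually_ge_at_top[of "exp 1"] eventually_ge_at_top[of "(real L + 1)\<^sup>2"]
  proof eventually_elim
    case (elim r)
    \<comment> \<open>ln r \<ge> 1 lets the constant ln K be absorbed into the multiple of ln
      r.\<close>
    have r: "r > 0" "1 \<le> ln r" "1 \<le> r"
      using elim(2) exp_gt_zero[of 1] ln_ge_iff[of r 1] exp_ge_add_one_self[of 1] by linarith+
    define \<rho> where "\<rho> = sqrt r"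
    have \<rho>: "\<rho> > 0" "\<rho>\<^sup>2 = r" "real L + 1 \<le> \<rho>"
      using r elim(3) by (auto simp: \<rho>_def real_le_rsqrt)
    obtain h N where hN: "\<And>k. k \<in> J \<Longrightarrow> h k integrable_on {0..2*pi}" "\<And>k \<theta>. k \<in> J \<Longrightarrow> 0 \<le> h k \<theta>"
       "\<And>k. k \<in> J \<Longrightarrow> finite (N k)"
       "\<And>k. k \<in> J \<Longrightarrow> integral {0..2*pi} (h k) \<le> C k * r powr q"
       "\<And>k \<theta>. k \<in> J \<Longrightarrow> \<theta>\<in>{0..2*pi} - N k \<Longrightarrow> \<bar>ln (norm (f ((of_real \<rho> * cis (\<theta> / 2) + \<i> * of_real (of_int k) / 2)\<^sup>2)))
           - ln (norm (f ((of_real \<rho> * cis (\<theta> / 2))\<^sup>2)))\<bar> \<le> h k \<theta>"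
      using elim(1) unfolding \<rho>_def[symmetric] by metis
    define H0 where "H0 \<theta> = (\<Sum>k\<in>J. h k \<theta>)" for \<theta>
    define H where "H \<theta> = ln K + real \<kappa> * ln r + real D * H0 \<theta>" for \<theta>
    \<comment> \<open>The angles at which a majorant may fail, at which z^2 is exceptional, or at
      which the equation is violated by irrelevant values.\<close>
    define B where "B = (\<Union>k\<in>J. N k) \<union> {\<theta> \<in> {0..2*pi}. (of_real \<rho> * cis (\<theta> / 2) + 0)\<^sup>2 \<in> exceptional}
        \<union> {\<theta> \<in> {0..2*pi}. (of_real \<rho> * cis (\<theta> / 2) + 0)\<^sup>2 \<in> E}"
    have finB: "finite B"
      unfolding B_def by (intro finite_UnI finite_UN_I finite_shifted_square_angles finite_exceptional finE \<rho>(1) hN(3)) (auto simp: J_def)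
    have H0: "H0 \<theta> \<ge> 0" for \<theta> unfolding H0_def by (intro sum_nonneg hN(2))
    have H: "H \<theta> \<ge> 0" for \<theta> unfolding H_def using K(1) r H0 by (intro add_nonneg_nonneg mult_nonneg_nonneg) auto
    have intH0: "(H0 has_integral (\<Sum>k\<in>J. integral {0..2*pi} (h k))) {0..2*pi}"
      unfolding H0_def by (intro has_integral_sum integrable_integral hN(1)) (auto simp: J_def)
    have intH: "(H has_integral (2 * pi * (ln K + real \<kappa> * ln r) + real D * (\<Sum>k\<in>J. integral {0..2*pi} (h k)))) {0..2*pi}"
      unfolding H_def using has_integral_add[OF has_integral_const_real[of "ln K + real \<kappa> * ln r" 0 "2 * pi"] has_integral_mult_right[OF intH0, of "real D"]]
      by simp
    have "integral {0..2*pi} (\<lambda>\<theta>. ln_plus (cmod (wilson_poly_eval P f (of_real r * exp (\<i> * of_real \<theta>))))) \<le> integral {0..2*pi} H"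
    proof (rule integral_le_off_finite[OF _ H finB])
      show "H integrable_on {0..2*pi}" using intH by blast
      fix \<theta> assume \<theta>: "\<theta> \<in> {0..2*pi} - B"
      define z where "z = of_real \<rho> * cis (\<theta> / 2)"
      have nz: "norm z = \<rho>" using \<rho> by (simp add: z_def norm_mult)
      have z2: "z\<^sup>2 = of_real r * exp (\<i> * of_real \<theta>)"
      proof -
        have "z\<^sup>2 = of_real (\<rho>\<^sup>2) * (cis (\<theta> / 2) * cis (\<theta> / 2))" by (simp add: z_def power2_eq_square)
        also have "cis (\<theta> / 2) * cis (\<theta> / 2) = cis \<theta>" by (simp add: cis_mult)
        finally show ?thesis by (simp only: \<rho>(2) cis_conv_exp)
      qed
      have zb: "z\<^sup>2 \<notin> exceptional" "z\<^sup>2 \<notin> E" using \<theta> by (auto simp: B_def z_def)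
      define U where "U = exp (H0 \<theta>)"
      have "norm (wilson_poly_eval P f (z\<^sup>2)) \<le> K * norm (z\<^sup>2) ^ \<kappa> * U ^ D"
      proof (rule K(2))
        show "real L + 1 \<le> norm z" using \<rho> nz by simp
        show "1 \<le> U" using H0 by (simp add: U_def)
        show fz: "f (z\<^sup>2) \<noteq> 0" using zb by (simp add: exceptional_def)
        show "f (z\<^sup>2) ^ n * wilson_poly_eval P f (z\<^sup>2) = wilson_poly_eval Q f (z\<^sup>2)" using zb by (simp add: E_def)
        fix k :: int assume "\<bar>k\<bar> \<le> int L"
        hence k: "k \<in> J" by (auto simp: J_def)
        define w where "w = (z + \<i> * of_int k / 2)\<^sup>2"
        have "h k \<theta> \<le> H0 \<theta>"
          unfolding H0_def by (rule member_le_sum[OF k]) (auto simp: J_def intro: hN(2))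
        moreover have "\<bar>ln (norm (f w)) - ln (norm (f (z\<^sup>2)))\<bar> \<le> h k \<theta>"
          using hN(5)[OF k, of \<theta>] \<theta> k by (auto simp: B_def w_def z_def)
        ultimately have le: "ln (norm (f w)) \<le> H0 \<theta> + ln (norm (f (z\<^sup>2)))" by linarith
        \<comment> \<open>For f w = 0 the convention ln 0 = 0 makes \<open>le\<close> uninformative,
          but then the claim is trivial.\<close>
        have "norm (f w) \<le> U * norm (f (z\<^sup>2))"
        proof (cases "f w = 0")
          case False
          hence "norm (f w) = exp (ln (norm (f w)))" by simp
          also have "\<dots> \<le> exp (H0 \<theta> + ln (norm (f (z\<^sup>2))))" using le by simp
          also have "\<dots> = U * norm (f (z\<^sup>2))" using fz by (simp add: exp_add U_def)
          finally show ?thesis .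
        qed (simp add: U_def)
        thus "norm (f ((z + \<i> * of_int k / 2)\<^sup>2)) \<le> U * norm (f (z\<^sup>2))" by (simp add: w_def)
      qed
      also have "norm (z\<^sup>2) = r" by (simp add: norm_power nz \<rho>)
      also have "K * r ^ \<kappa> * U ^ D = exp (H \<theta>)"
        using K(1) r by (simp add: H_def U_def exp_add exp_of_nat_mult)
      finally have "max 1 (norm (wilson_poly_eval P f (z\<^sup>2))) \<le> exp (H \<theta>)" using H[of \<theta>] by simp
      hence "ln_plus (norm (wilson_poly_eval P f (z\<^sup>2))) \<le> ln (exp (H \<theta>))"
        unfolding ln_plus_def by (subst ln_le_cancel_iff) auto
      thus "ln_plus (cmod (wilson_poly_eval P f (of_real r * exp (\<i> * of_real \<theta>)))) \<le> H \<theta>"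
        by (simp add: z2)
    qed
    also have "\<dots> = 2 * pi * (ln K + real \<kappa> * ln r) + real D * (\<Sum>k\<in>J. integral {0..2*pi} (h k))"
      using intH by (rule integral_unique)
    also have "\<dots> \<le> 2 * pi * (ln K + real \<kappa> * ln r) + real D * (\<Sum>k\<in>J. C k * r powr q)"
      by (intro add_left_mono mult_left_mono sum_mono hN(4)) auto
    finally have "proximity r (wilson_poly_eval P f) \<le>
        1 / (2 * pi) * (2 * pi * (ln K + real \<kappa> * ln r) + real D * (\<Sum>k\<in>J. C k * r powr q))"
      unfolding proximity_def by (intro mult_left_mono) auto
    also have "\<dots> = ln K + real \<kappa> * ln r + C1 * r powr q"
      by (simp add: C1_def field_simps flip: sum_distrib_right)
    also have "\<dots> \<le> C1 * r powr q + C2 * ln r"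
      using mult_left_mono[OF r(2), of "ln K"] K(1) by (simp add: C2_def algebra_simps)
    finally show ?case .
  qed
  thus ?thesis using that[OF C1 C2] by (simp add: q_def)
qed

theorem theorem6p4:
  fixes n :: nat and P Q :: wilson_poly and f :: "complex \<Rightarrow> complex" and \<sigma> :: real
  assumes "n > 0"
    and "wilson_poly_degree Q \<le> n"
    and "f meromorphic_on UNIV"
    and "\<not> (\<forall>\<^sub>\<approx>x. f x = 0)"
    and "nevanlinna_order f = ereal \<sigma>"
    and "\<forall>\<^sub>\<approx>x. f x ^ n * wilson_poly_eval P f x = wilson_poly_eval Q f x"
  shows "\<forall>\<epsilon>>0. \<exists>A B :: real \<Rightarrow> real.
           A \<in> O(\<lambda>r. r powr (\<sigma> - 1 / 2 + \<epsilon>)) \<and> B \<in> O(\<lambda>r. ln r) \<and>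
           (\<forall>\<^sub>F r in at_top. proximity r (wilson_poly_eval P f) = A r + B r)"
proof (intro allI impI)
  fix \<epsilon> :: real assume "\<epsilon> > 0"
  then obtain C1 C2 where C: "C1 \<ge> 0" "C2 \<ge> 0" and
    le: "\<forall>\<^sub>F r in at_top. proximity r (wilson_poly_eval P f) \<le> C1 * r powr (\<sigma> - 1 / 2 + \<epsilon>) + C2 * ln r"
    by (rule proximity_wilson_poly_le[OF assms(2-6)])
  \<comment> \<open>The conclusion asks for an exact splitting. The proximity function is cut off at
    the bound for the first part; what exceeds it is at most C2 * ln r.\<close>
  define A where "A r = min (proximity r (wilson_poly_eval P f)) (C1 * r powr (\<sigma> - 1 / 2 + \<epsilon>))" for r
  define B where "B r = proximity r (wilson_poly_eval P f) - A r" for r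
  have "0 \<le> A r" "A r \<le> C1 * r powr (\<sigma> - 1 / 2 + \<epsilon>)" for r
    using C proximity_nonneg by (auto simp: A_def)
  hence "A \<in> O(\<lambda>r. r powr (\<sigma> - 1 / 2 + \<epsilon>))"
    by (intro bigoI[of _ C1] always_eventually) auto
  moreover have "B \<in> O(\<lambda>r. ln r)"
  proof (rule bigoI[of _ C2])
    show "\<forall>\<^sub>F r in at_top. norm (B r) \<le> C2 * norm (ln r)"
      using le eventually_ge_at_top[of 1]
    proof eventually_elim
      case (elim r)
      hence "0 \<le> C2 * ln r" using C by simp
      thus ?case using elim by (auto simp: A_def B_def min_def)
    qed
  qed
  ultimately show "\<exists>A B :: real \<Rightarrow> real.
           A \<in> O(\<lambda>r. r powr (\<sigma> - 1 / 2 + \<epsilon>)) \<and> B \<in> O(\<lambda>r. ln r) \<and>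
           (\<forall>\<^sub>F r in at_top. proximity r (wilson_poly_eval P f) = A r + B r)"
    by (intro exI[of _ A] exI[of _ B]) (auto simp: B_def)
qed

end
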